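(* Let $X$ be a split $\iota$-complex (a split geometric complex whose associated $\mathbb{F}[U]$-complex satisfies $U^{-1}H_*\cong\mathbb{F}[U,U^{-1}]$), and let $\Delta$ be a non-negative even integer with $2\Delta\le\mathrm{width}(X)$. Then for any choice of splitting, the double $X^d(\Delta)$ (with the involution $J$) is locally equivalent, as an $\iota$-complex, to $X\otimes X_\Delta$ (with involution $J\otimes J$).
   Context: $\mathbb{F}=\mathbb{Z}/2$, $\deg U=-2$. Geometric complex: a finite-dimensional chain complex $C_{cell}$ over $\mathbb{F}$ with a distinguished basis of "cells", each cell $e$ having an integer dimension $\dim e$ with the differential lowering dimension by one, together with a function $\mathrm{gr}$ from cells to a coset of $2\mathbb{Z}$ in $\mathbb{Q}$ such that $\mathrm{gr}(e')\ge\mathrm{gr}(e)$ whenever $e'$ appears in $\partial e$. The associated $\mathbb{F}[U]$-complex is $C_{cell}\otimes\mathbb{F}[U]$ with Maslov grading $M(e)=\mathrm{gr}(e)+\dim e$ and differential $\partial e=\sum_{e'\in\partial e}U^{(\mathrm{gr}(e')-\mathrm{gr}(e))/2}e'$. The width of a cell $e$ is $\min\{\mathrm{gr}(e')-\mathrm{gr}(e): e'\text{ appears in }\partial e\}$ ($\infty$ if $\partial e=0$), and $\mathrm{width}(X)$ is the minimum over all cells. The geometric complex is split if it carries an involution $J$ of $C_{cell}$ permuting cells, commuting with $\partial$, preserving $\dim$ and $\mathrm{gr}$, with exactly one fixed cell $\eta$; $J$ extends $U$-equivariantly to a grading-preserving chain involution, and when $U^{-1}H_*\cong\mathbb{F}[U,U^{-1}]$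 the pair is an $\iota$-complex. Tensor products of geometric complexes: cells are products $x\cdot y$, $\dim$ and $\mathrm{gr}$ add, differential by the Leibniz rule, $J$ acts diagonally. $X_\Delta$ is the split geometric complex with cells $\alpha,J\alpha$ (dimension $0$, $\mathrm{gr}=0$) and $\beta$ (dimension $1$, $\mathrm{gr}=-2\Delta$, $J$-fixed), $\partial\beta=\alpha+J\alpha$. Doubling: choose a splitting, i.e. a set of cells containing exactly one from each $J$-orbit of size two; let $C$ be its span, so $C_{cell}=C\oplus JC\oplus\mathbb{F}\eta$. Each $x\in C$ has $\partial x=a+(1+J)b$ or $\partial x=a+(1+J)b+\eta$ uniquely with $a,b\in C$, and $\partial\eta=(1+J)\zeta$ for some $\zeta\in C$. The skeleton of $X^d(\Delta)$ is $(C\oplus\mathbb{F}\omega)\oplus(JC\oplus\mathbb{F}J\omega)\oplus\mathbb{F}\theta$ with new cells $\omega,J\omega,\theta$; $J$ swaps $C,JC$ as before, swaps $\omega,J\omega$, fixes $\theta$. Differential $\partial^d$: for $x\in C$, $\partial^dx=a+(1+J)b$ if $\partial x=a+(1+J)b$ and $\eta$ does not appear in $\partial b$; $\partial^dx=a+(1+J)b+\theta$ if $\partial x=a+(1+J)b$ and $\eta$ appears in $\partial b$; $\partial^dx=a+(1+J)b+\omega$ if $\partial x=a+(1+J)b+\eta$; $\partial^d\omega=(1+J)\zeta$; $\partial^d\theta=(1+J)\omega$; extended to $JC$, $J\omega$ by $J$-equivariance. Gradings: cells of $C,JC$ keep their $\dim$ and $\mathrm{gr}$; $\omega,J\omega$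 have $\dim=\dim\eta$, $\mathrm{gr}=\mathrm{gr}(\eta)$; $\theta$ has $\dim=\dim\eta+1$, $\mathrm{gr}=\mathrm{gr}(\eta)-2\Delta$. This is a split geometric complex. Local equivalence of $\iota$-complexes $(C,\iota),(C',\iota')$: existence of grading-preserving chain maps in both directions commuting with the involutions up to homotopy and inducing isomorphisms on $U^{-1}H_*$. *)

theory Defs
  imports Main "HOL-Library.Extended_Real"
begin

text \<open>A (split) geometric complex: a finite set of cells; bd e is the set of cells
appearing in the boundary of e (coefficients in Z/2); dimension, grading gr,
and the involution J (invol).  Chains over Z/2 are finite sets of cells,
addition is symmetric difference.\<close>

record 'c gcx =
  cells :: "'c set"
  bd :: "'c \<Rightarrow> 'c set"
  dimc :: "'c \<Rightarrow> int"
  grc :: "'c \<Rightarrow> rat"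
  invol :: "'c \<Rightarrow> 'c"

definition addc :: "'a set \<Rightarrow> 'a set \<Rightarrow> 'a set" where
  "addc A B = (A - B) \<union> (B - A)"

definition chain_bd :: "('c \<Rightarrow> 'c set) \<Rightarrow> 'c set \<Rightarrow> 'c set" where
  "chain_bd d A = {x. odd (card {e\<in>A. x \<in> d e})}"

definition geom_complex :: "'c gcx \<Rightarrow> bool" where
  "geom_complex X \<longleftrightarrow>
     finite (cells X) \<and>
     (\<forall>e\<in>cells X. bd X e \<subseteq> cells X \<and>
        (\<forall>e'\<in>bd X e. dimc X e' = dimc X e - 1 \<and> grc X e \<le> grc X e')) \<and>
     (\<exists>r::rat. \<forall>e\<in>cells X. \<exists>k::int. grc X e = r + 2 * of_int k) \<and>
     (\<forall>e\<in>cells X. chain_bd (bd X) (bd X e) = {})"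

definition split_gc :: "'c gcx \<Rightarrow> bool" where
  "split_gc X \<longleftrightarrow> geom_complex X \<and>
     invol X ` cells X \<subseteq> cells X \<and>
     (\<forall>e\<in>cells X. invol X (invol X e) = e \<and>
        bd X (invol X e) = invol X ` bd X e \<and>
        dimc X (invol X e) = dimc X e \<and> grc X (invol X e) = grc X e) \<and>
     (\<exists>!e. e \<in> cells X \<and> invol X e = e)"

text \<open>Width of a geometric complex (infinity when there are no boundary pairs).\<close>
definition width :: "'c gcx \<Rightarrow> ereal" where
  "width X = (INF e\<in>cells X. INF e'\<in>bd X e. ereal (of_rat (grc X e' - grc X e)))"

text \<open>Elements of C_cell \<otimes> F[U] (resp. of the localization C_cell \<otimes> F[U,U^-1])
are finite sets of pairs (e,n) standing for U^n e, with n \<ge> 0 (resp. n \<in> Z).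
An F[U]-linear map is determined by its values f e on cells.\<close>

definition dU :: "'c gcx \<Rightarrow> 'c \<Rightarrow> ('c \<times> int) set" where
  "dU X e = (\<lambda>x. (x, \<lfloor>(grc X x - grc X e) / 2\<rfloor>)) ` bd X e"

definition lin_ext :: "('c \<Rightarrow> ('d \<times> int) set) \<Rightarrow> ('c \<times> int) set \<Rightarrow> ('d \<times> int) set" where
  "lin_ext f A = {(y, m). odd (card {(e, n). (e, n) \<in> A \<and> (y, m - n) \<in> f e})}"

definition maslov :: "'c gcx \<Rightarrow> 'c \<Rightarrow> rat" where
  "maslov X e = grc X e + of_int (dimc X e)"

definition fu_map :: "'c gcx \<Rightarrow> 'd gcx \<Rightarrow> ('c \<Rightarrow> ('d \<times> int) set) \<Rightarrow> int \<Rightarrow> bool" where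
  "fu_map X Y f deg \<longleftrightarrow> (\<forall>e\<in>cells X. finite (f e) \<and>
      (\<forall>(y, k)\<in>f e. y \<in> cells Y \<and> 0 \<le> k \<and>
          maslov Y y - 2 * of_int k = maslov X e + of_int deg))"

definition chain_map :: "'c gcx \<Rightarrow> 'd gcx \<Rightarrow> ('c \<Rightarrow> ('d \<times> int) set) \<Rightarrow> bool" where
  "chain_map X Y f \<longleftrightarrow> fu_map X Y f 0 \<and>
     (\<forall>e\<in>cells X. lin_ext f (dU X e) = lin_ext (dU Y) (f e))"

definition commutes_up_to_htpy :: "'c gcx \<Rightarrow> 'd gcx \<Rightarrow> ('c \<Rightarrow> ('d \<times> int) set) \<Rightarrow> bool" where
  "commutes_up_to_htpy X Y f \<longleftrightarrow> (\<exists>H. fu_map X Y H 1 \<and>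
     (\<forall>e\<in>cells X. addc (f (invol X e)) ((\<lambda>(y, k). (invol Y y, k)) ` f e)
                  = addc (lin_ext (dU Y) (H e)) (lin_ext H (dU X e))))"

definition chainL :: "'c gcx \<Rightarrow> ('c \<times> int) set \<Rightarrow> bool" where
  "chainL X A \<longleftrightarrow> finite A \<and> fst ` A \<subseteq> cells X"

definition cycleL :: "'c gcx \<Rightarrow> ('c \<times> int) set \<Rightarrow> bool" where
  "cycleL X A \<longleftrightarrow> chainL X A \<and> lin_ext (dU X) A = {}"

definition bdryL :: "'c gcx \<Rightarrow> ('c \<times> int) set \<Rightarrow> bool" where
  "bdryL X A \<longleftrightarrow> (\<exists>B. chainL X B \<and> A = lin_ext (dU X) B)"

definition loc_hiso :: "'c gcx \<Rightarrow> 'd gcx \<Rightarrow> ('c \<Rightarrow> ('d \<times> int) set) \<Rightarrow> bool" where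
  "loc_hiso X Y f \<longleftrightarrow>
     (\<forall>z. cycleL Y z \<longrightarrow> (\<exists>w. cycleL X w \<and> bdryL Y (addc (lin_ext f w) z))) \<and>
     (\<forall>w. cycleL X w \<and> bdryL Y (lin_ext f w) \<longrightarrow> bdryL X w)"

definition local_equiv :: "'c gcx \<Rightarrow> 'd gcx \<Rightarrow> bool" where
  "local_equiv X Y \<longleftrightarrow>
     (\<exists>f. chain_map X Y f \<and> commutes_up_to_htpy X Y f \<and> loc_hiso X Y f) \<and>
     (\<exists>g. chain_map Y X g \<and> commutes_up_to_htpy Y X g \<and> loc_hiso Y X g)"

text \<open>p(U) \<cdot> z for the Laurent polynomial p = sum_{k\<in>S} U^k.\<close>
definition ushift :: "int set \<Rightarrow> ('c \<times> int) set \<Rightarrow> ('c \<times> int) set" where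
  "ushift S z = {(e, m). odd (card {k\<in>S. (e, m - k) \<in> z})}"

text \<open>U^-1 H_* \<cong> F[U,U^-1]: free of rank one, generated by the class of a cycle z.\<close>
definition iota_complex :: "'c gcx \<Rightarrow> bool" where
  "iota_complex X \<longleftrightarrow> split_gc X \<and>
     (\<exists>z. cycleL X z \<and>
        (\<forall>w. cycleL X w \<longrightarrow> (\<exists>!S. finite S \<and> bdryL X (addc w (ushift S z)))))"

datatype xdcell = Al | JAl | Be

definition XD :: "int \<Rightarrow> xdcell gcx" where
  "XD \<Delta> = \<lparr> cells = UNIV,
             bd = (\<lambda>c. if c = Be then {Al, JAl} else {}),
             dimc = (\<lambda>c. if c = Be then 1 else 0),
             grc = (\<lambda>c. if c = Be then - 2 * of_int \<Delta> else 0),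
             invol = (\<lambda>c. case c of Al \<Rightarrow> JAl | JAl \<Rightarrow> Al | Be \<Rightarrow> Be) \<rparr>"

definition tensor :: "'c gcx \<Rightarrow> 'd gcx \<Rightarrow> ('c \<times> 'd) gcx" where
  "tensor X Y = \<lparr> cells = cells X \<times> cells Y,
     bd = (\<lambda>(x, y). addc ((\<lambda>x'. (x', y)) ` bd X x) ((\<lambda>y'. (x, y')) ` bd Y y)),
     dimc = (\<lambda>(x, y). dimc X x + dimc Y y),
     grc = (\<lambda>(x, y). grc X x + grc Y y),
     invol = (\<lambda>(x, y). (invol X x, invol Y y)) \<rparr>"

definition is_splitting :: "'c gcx \<Rightarrow> 'c set \<Rightarrow> bool" where
  "is_splitting X S \<longleftrightarrow> S \<subseteq> cells X \<and> (\<forall>e\<in>S. invol X e \<noteq> e) \<and>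
     (\<forall>e\<in>cells X. invol X e \<noteq> e \<longrightarrow> (e \<in> S \<longleftrightarrow> invol X e \<notin> S))"

definition eta :: "'c gcx \<Rightarrow> 'c" where
  "eta X = (THE e. e \<in> cells X \<and> invol X e = e)"

text \<open>For x in C: bd x = a + (1+J) b (+ eta), with a, b in C = span S.  These are the
unique such a, b: the JC-part of bd x is J b, the C-part is a + b.\<close>
definition bpart :: "'c gcx \<Rightarrow> 'c set \<Rightarrow> 'c \<Rightarrow> 'c set" where
  "bpart X S x = invol X ` (bd X x \<inter> invol X ` S)"

definition apart :: "'c gcx \<Rightarrow> 'c set \<Rightarrow> 'c \<Rightarrow> 'c set" where
  "apart X S x = addc (bd X x \<inter> S) (bpart X S x)"

text \<open>bd eta = (1+J) zeta with zeta in C.\<close>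
definition zeta :: "'c gcx \<Rightarrow> 'c set \<Rightarrow> 'c set" where
  "zeta X S = invol X ` (bd X (eta X) \<inter> invol X ` S)"

datatype 'c dcell = Old 'c | Omega | JOmega | Theta

definition dJ :: "'c gcx \<Rightarrow> 'c dcell \<Rightarrow> 'c dcell" where
  "dJ X c = (case c of Old x \<Rightarrow> Old (invol X x) | Omega \<Rightarrow> JOmega
              | JOmega \<Rightarrow> Omega | Theta \<Rightarrow> Theta)"

definition dbd_S :: "'c gcx \<Rightarrow> 'c set \<Rightarrow> 'c \<Rightarrow> 'c dcell set" where
  "dbd_S X S x = addc
     (Old ` addc (apart X S x) (addc (bpart X S x) (invol X ` bpart X S x)))
     (if eta X \<in> bd X x then {Omega}
      else if eta X \<in> chain_bd (bd X) (bpart X S x) then {Theta} else {})"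

definition double :: "'c gcx \<Rightarrow> 'c set \<Rightarrow> int \<Rightarrow> 'c dcell gcx" where
  "double X S \<Delta> = \<lparr>
     cells = Old ` (cells X - {eta X}) \<union> {Omega, JOmega, Theta},
     bd = (\<lambda>c. case c of
             Old x \<Rightarrow> (if x \<in> S then dbd_S X S x else dJ X ` dbd_S X S (invol X x))
           | Omega \<Rightarrow> Old ` addc (zeta X S) (invol X ` zeta X S)
           | JOmega \<Rightarrow> Old ` addc (zeta X S) (invol X ` zeta X S)
           | Theta \<Rightarrow> {Omega, JOmega}),
     dimc = (\<lambda>c. case c of Old x \<Rightarrow> dimc X x | Theta \<Rightarrow> dimc X (eta X) + 1
                 | _ \<Rightarrow> dimc X (eta X)),
     grc = (\<lambda>c. case c of Old x \<Rightarrow> grc X x | Theta \<Rightarrow> grc X (eta X) - 2 * of_int \<Delta>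
                 | _ \<Rightarrow> grc X (eta X)),
     invol = dJ X \<rparr>"

end

theory Submission
  imports Defs
begin

text \<open>The double is a strictly \<open>J\<close>-equivariant deformation retract of \<open>X \<otimes> X\<^sub>\<Delta>\<close>. The inclusion
  sends \<open>x\<close> in \<open>C\<close> to \<open>x\<cdot>\<alpha> + Jb\<cdot>\<beta>\<close> (with \<open>b\<close> as in \<open>\<partial>x = a + (1 + J)b + \<dots>\<close>), \<open>\<omega>\<close> to
  \<open>\<eta>\<cdot>\<alpha> + J\<zeta>\<cdot>\<beta>\<close> and \<open>\<theta>\<close> to \<open>\<eta>\<cdot>\<beta>\<close>; the bound on the width is what keeps it from lowering
  \<open>gr\<close>. The retraction sends \<open>x\<cdot>\<alpha>\<close> to \<open>x\<close>, \<open>Jx\<cdot>\<alpha>\<close> to \<open>Jx\<close> plus \<open>\<theta>\<close> if \<open>\<eta>\<close> appears in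
  \<open>\<partial>x\<close>, \<open>\<eta>\<cdot>\<alpha>\<close> to \<open>\<omega>\<close> and \<open>\<eta>\<cdot>\<beta>\<close> to \<open>\<theta>\<close>, and kills the other cells \<open>e\<cdot>\<beta>\<close>. It is a left
  inverse of the inclusion, and \<open>Jx\<cdot>\<alpha> \<mapsto> Jx\<cdot>\<beta>\<close>, extended equivariantly, is a homotopy from the
  other composite to the identity. This homotopy lowers \<open>gr\<close>, so it exists only after inverting
  \<open>U\<close>, which is all that local equivalence asks for.\<close>

section \<open>Chains over Z/2\<close>

lemma in_addc [simp]: "x \<in> addc A B \<longleftrightarrow> (x \<in> A) \<noteq> (x \<in> B)"
  by (auto simp: addc_def)

lemma addc_self [simp]: "addc A A = {}"
  and addc_empty [simp]: "addc A {} = A" "addc {} A = A"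
  and addc_assoc: "addc (addc A B) C = addc A (addc B C)"
  and addc_commute: "addc A B = addc B A"
  and addc_cancel [simp]: "addc A (addc A B) = B"
  by (auto simp: set_eq_iff)

lemma finite_addc [simp]: "finite A \<Longrightarrow> finite B \<Longrightarrow> finite (addc A B)"
  by (simp add: addc_def)

lemma addc_subset: "A \<subseteq> C \<Longrightarrow> B \<subseteq> C \<Longrightarrow> addc A B \<subseteq> C"
  by (auto simp: addc_def)

lemma addc_disjoint: "A \<inter> B = {} \<Longrightarrow> addc A B = A \<union> B"
  by (auto simp: addc_def)

lemma image_addc: "inj_on i (A \<union> B) \<Longrightarrow> i ` addc A B = addc (i ` A) (i ` B)"
  by (auto simp: addc_def inj_on_def)

text \<open>Common elements are counted twice in \<open>card A + card B\<close> and not at all in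
  \<open>addc A B\<close>, so parity ignores them. Both additivity rules for
  \<open>chain_ext\<close> rest on this count.\<close>

lemma odd_card_addc:
  assumes "finite A" "finite B"
  shows "odd (card (addc A B)) \<longleftrightarrow> odd (card A) \<noteq> odd (card B)"
proof -
  have "card (addc A B) = card (A - B) + card (B - A)"
    using assms by (auto simp: addc_def intro!: card_Un_disjoint)
  moreover have "card A = card (A - B) + card (A \<inter> B)"
    using assms by (metis Int_commute card_Diff_subset_Int card_mono finite_Int inf_le1 le_add_diff_inverse2)
  moreover have "card B = card (B - A) + card (A \<inter> B)"
    using assms by (metis Int_commute card_Diff_subset_Int card_mono finite_Int inf_le1 le_add_diff_inverse2)
  ultimately show ?thesis by auto
qed

section \<open>Linear extension of maps on cells\<close>

text \<open>\<^const>\<open>chain_bd\<close> is typed for endomorphisms only.\<close>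

definition chain_ext :: "('c \<Rightarrow> 'd set) \<Rightarrow> 'c set \<Rightarrow> 'd set" where
  "chain_ext d A = {x. odd (card {e\<in>A. x \<in> d e})}"

lemma chain_bd_eq: "chain_bd = chain_ext"
  by (simp add: chain_bd_def chain_ext_def fun_eq_iff)

lemma chain_ext_addc:
  assumes "finite A" "finite B"
  shows "chain_ext d (addc A B) = addc (chain_ext d A) (chain_ext d B)"
proof -
  have "{e \<in> addc A B. x \<in> d e} = addc {e \<in> A. x \<in> d e} {e \<in> B. x \<in> d e}" for x
    by auto
  then show ?thesis
    using assms by (auto simp: chain_ext_def odd_card_addc)
qed

lemma chain_ext_empty [simp]: "chain_ext d {} = {}"
  by (simp add: chain_ext_def)

lemma chain_ext_singleton [simp]: "chain_ext d {e} = d e"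
proof -
  have "{e'. e' = e \<and> x \<in> d e'} = (if x \<in> d e then {e} else {})" for x
    by auto
  then show ?thesis by (auto simp: chain_ext_def)
qed

lemma chain_ext_insert:
  "finite A \<Longrightarrow> e \<notin> A \<Longrightarrow> chain_ext d (insert e A) = addc (d e) (chain_ext d A)"
  using chain_ext_addc [of "{e}" A d] by (simp add: addc_disjoint)

lemma chain_ext_cong: "(\<And>e. e \<in> A \<Longrightarrow> d e = d' e) \<Longrightarrow> chain_ext d A = chain_ext d' A"
  unfolding chain_ext_def by (rule Collect_cong, rule arg_cong [where f = "\<lambda>B. odd (card B)"]) auto

lemma chain_ext_subset: "(\<And>e. e \<in> A \<Longrightarrow> d e \<subseteq> B) \<Longrightarrow> chain_ext d A \<subseteq> B"
  by (auto simp: chain_ext_def dest!: odd_card_imp_not_empty)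

lemma finite_chain_ext:
  assumes "finite A" "\<And>e. e \<in> A \<Longrightarrow> finite (d e)"
  shows "finite (chain_ext d A)"
  by (rule finite_subset [OF chain_ext_subset [of A d "\<Union> (d ` A)"]]) (use assms in auto)

lemma chain_ext_zero [simp]: "chain_ext (\<lambda>e. {}) A = {}"
  by (simp add: chain_ext_def)

lemma chain_ext_id [simp]: "finite A \<Longrightarrow> chain_ext (\<lambda>e. {e}) A = A"
  by (induction A rule: finite_induct) (simp_all add: chain_ext_insert addc_disjoint)

lemma chain_ext_add_fun:
  assumes "finite A"
  shows "chain_ext (\<lambda>e. addc (d e) (d' e)) A = addc (chain_ext d A) (chain_ext d' A)"
proof -
  have "{e \<in> A. x \<in> addc (d e) (d' e)} = addc {e \<in> A. x \<in> d e} {e \<in> A. x \<in> d' e}" for x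
    by auto
  then show ?thesis
    using assms by (auto simp: chain_ext_def odd_card_addc)
qed

text \<open>By additivity, composites of linear maps need only be compared on single cells, which is
  how all the identities below are checked.\<close>

lemma chain_ext_chain_ext:
  assumes "finite A" "\<And>e. e \<in> A \<Longrightarrow> finite (d e)"
  shows "chain_ext d' (chain_ext d A) = chain_ext (\<lambda>e. chain_ext d' (d e)) A"
  using assms
  by (induction A rule: finite_induct) (simp_all add: chain_ext_insert chain_ext_addc finite_chain_ext)

lemma chain_ext_Int: "chain_ext (\<lambda>e. d e \<inter> B) A = chain_ext d A \<inter> B"
proof -
  have "{e \<in> A. x \<in> d e \<inter> B} = (if x \<in> B then {e \<in> A. x \<in> d e} else {})" for x
    by auto
  then show ?thesis by (auto simp: chain_ext_def)
qed

text \<open>Injectivity on a set containing every \<open>d e\<close> rules out cancellation between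
  different cells with the same image.\<close>

lemma chain_ext_image:
  assumes "inj_on i B" "\<And>e. e \<in> A \<Longrightarrow> d e \<subseteq> B"
  shows "chain_ext (\<lambda>e. i ` d e) A = i ` chain_ext d A"
proof -
  have *: "{e \<in> A. i x \<in> i ` d e} = {e \<in> A. x \<in> d e}" if "x \<in> B" for x
    using assms that by (blast dest: inj_onD)
  have "i x \<in> chain_ext (\<lambda>e. i ` d e) A \<longleftrightarrow> x \<in> chain_ext d A" if "x \<in> B" for x
    using * [OF that] by (simp add: chain_ext_def)
  moreover have "chain_ext d A \<subseteq> B" "chain_ext (\<lambda>e. i ` d e) A \<subseteq> i ` B"
    using assms(2) by (auto intro!: chain_ext_subset)
  ultimately show ?thesis
    by blast
qed

lemma chain_ext_reindex:
  assumes "inj_on i A"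
  shows "chain_ext d (i ` A) = chain_ext (\<lambda>e. d (i e)) A"
proof -
  have "{e \<in> i ` A. x \<in> d e} = i ` {e \<in> A. x \<in> d (i e)}" for x
    by auto
  moreover have "inj_on i {e \<in> A. x \<in> d (i e)}" for x
    using assms by (auto intro: inj_on_subset)
  ultimately show ?thesis
    by (simp add: chain_ext_def card_image)
qed

section \<open>Cell maps and their equivariant lifts\<close>

text \<open>The exponent of \<open>U\<close> is the only one for which the map preserves
  \<open>gr\<close>; for \<open>F = bd X\<close> this is the differential. It may be negative, so in
  general the lift lives over the Laurent polynomials.\<close>

definition glift :: "'c gcx \<Rightarrow> 'd gcx \<Rightarrow> ('c \<Rightarrow> 'd set) \<Rightarrow> 'c \<Rightarrow> ('d \<times> int) set" where
  "glift X Y F e = (\<lambda>y. (y, \<lfloor>(grc Y y - grc X e) / 2\<rfloor>)) ` F e"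

lemma dU_eq_glift: "dU X = glift X X (bd X)"
  by (simp add: dU_def glift_def fun_eq_iff)

text \<open>The representative \<open>r\<close> of the coset is a parameter, so that two complexes
  can be measured against the same one.\<close>

definition graded_over :: "rat \<Rightarrow> 'c gcx \<Rightarrow> bool" where
  "graded_over r X \<longleftrightarrow> (\<forall>e\<in>cells X. \<exists>k::int. grc X e = r + 2 * of_int k)"

definition level :: "rat \<Rightarrow> 'c gcx \<Rightarrow> 'c \<Rightarrow> int" where
  "level r X e = \<lfloor>(grc X e - r) / 2\<rfloor>"

text \<open>The homogeneous part of a Laurent chain, rescaled so that all powers of \<open>U\<close> disappear.\<close>

definition slice :: "rat \<Rightarrow> 'c gcx \<Rightarrow> int \<Rightarrow> ('c \<times> int) set \<Rightarrow> 'c set" where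
  "slice r X t A = {e. (e, t + level r X e) \<in> A}"

lemma grc_level: "graded_over r X \<Longrightarrow> e \<in> cells X \<Longrightarrow> grc X e = r + 2 * of_int (level r X e)"
  by (auto simp: graded_over_def level_def)

text \<open>Each monomial \<open>U^m e\<close> is seen by exactly one slice, the one with
  \<open>t = m - level r X e\<close>.\<close>

lemma slice_eqI:
  assumes "\<And>t. slice r X t A = slice r X t B"
  shows "A = B"
proof -
  have "(e, m) \<in> A \<longleftrightarrow> (e, m) \<in> B" for e m
    using arg_cong [OF assms [of "m - level r X e"], of "\<lambda>B. e \<in> B"] by (simp add: slice_def)
  then show ?thesis by auto
qed

lemma slice_empty [simp]: "slice r X t {} = {}"
  and slice_addc: "slice r X t (addc A B) = addc (slice r X t A) (slice r X t B)"
  by (auto simp: slice_def)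

lemma slice_chainL:
  assumes "chainL X A"
  shows "slice r X t A \<subseteq> cells X" "finite (slice r X t A)"
proof -
  have *: "slice r X t A \<subseteq> fst ` A"
    by (force simp: slice_def)
  then show "slice r X t A \<subseteq> cells X"
    using assms by (auto simp: chainL_def)
  show "finite (slice r X t A)"
    using assms finite_subset [OF *] by (simp add: chainL_def)
qed

text \<open>From \<open>e\<close> to \<open>y\<close> the exponent grows by
  \<open>level r Y y - level r X e\<close>, so a lift preserves \<open>t\<close> and acts on each
  slice as the plain map \<open>F\<close>. Identities over the Laurent polynomials thereby reduce to
  identities over Z/2.\<close>

lemma slice_lin_ext:
  assumes "graded_over r X" "graded_over r Y" "chainL X A"
    and F: "\<And>e. e \<in> cells X \<Longrightarrow> F e \<subseteq> cells Y"
  shows "slice r Y t (lin_ext (glift X Y F) A) = chain_ext F (slice r X t A)"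
proof -
  \<comment> \<open>The exponent \<open>n\<close> is determined by \<open>e\<close>, so the pairs
    counted in \<open>lin_ext\<close> correspond to the cells counted in
    \<open>chain_ext\<close>.\<close>
  have *: "{(e, n). (e, n) \<in> A \<and> (y, t + level r Y y - n) \<in> glift X Y F e}
      = (\<lambda>e. (e, t + level r X e)) ` {e \<in> slice r X t A. y \<in> F e}" for y
  proof -
    have "(y, t + level r Y y - n) \<in> glift X Y F e \<longleftrightarrow> y \<in> F e \<and> n = t + level r X e"
      if "(e, n) \<in> A" for e n
    proof -
      have e: "e \<in> cells X"
        using that assms(3) by (force simp: chainL_def)
      have "(grc Y y - grc X e) / 2 = of_int (level r Y y - level r X e)" if "y \<in> F e"
        using that grc_level [OF assms(1) e] grc_level [OF assms(2) subsetD [OF F [OF e]]]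
        by (simp add: field_simps)
      then have "\<lfloor>(grc Y y - grc X e) / 2\<rfloor> = level r Y y - level r X e" if "y \<in> F e"
        using that by (simp only: floor_of_int)
      then show ?thesis
        by (auto simp: glift_def)
    qed
    then show ?thesis
      unfolding slice_def by blast
  qed
  show ?thesis
  proof (rule set_eqI)
    fix y
    have "y \<in> slice r Y t (lin_ext (glift X Y F) A) \<longleftrightarrow>
        odd (card {(e, n). (e, n) \<in> A \<and> (y, t + level r Y y - n) \<in> glift X Y F e})"
      by (simp only: slice_def lin_ext_def mem_Collect_eq case_prod_conv)
    also have "card {(e, n). (e, n) \<in> A \<and> (y, t + level r Y y - n) \<in> glift X Y F e}
        = card {e \<in> slice r X t A. y \<in> F e}"
      unfolding * by (rule card_image) (simp add: inj_on_def)
    finally show "y \<in> slice r Y t (lin_ext (glift X Y F) A) \<longleftrightarrow> y \<in> chain_ext F (slice r X t A)"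
      by (simp only: chain_ext_def mem_Collect_eq)
  qed
qed

section \<open>Linear extension over the Laurent polynomials\<close>

lemma lin_ext_subset: "lin_ext f A \<subseteq> (\<Union>(e, n)\<in>A. (\<lambda>(y, k). (y, k + n)) ` f e)"
proof
  fix p assume "p \<in> lin_ext f A"
  then obtain y m where p: "p = (y, m)"
    and odd: "odd (card {(e, n). (e, n) \<in> A \<and> (y, m - n) \<in> f e})"
    unfolding lin_ext_def by blast
  from odd have "{(e, n). (e, n) \<in> A \<and> (y, m - n) \<in> f e} \<noteq> {}"
    by (rule odd_card_imp_not_empty)
  then obtain e n where "(e, n) \<in> A" "(y, m - n) \<in> f e"
    by blast
  then have "p \<in> (\<lambda>(y, k). (y, k + n)) ` f e"
    using p by (intro image_eqI [of _ _ "(y, m - n)"]) simp_all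
  with \<open>(e, n) \<in> A\<close> show "p \<in> (\<Union>(e, n)\<in>A. (\<lambda>(y, k). (y, k + n)) ` f e)"
    by (intro UN_I [of "(e, n)"]) simp_all
qed

lemma lin_ext_empty [simp]: "lin_ext f {} = {}" "lin_ext (\<lambda>e. {}) A = {}"
  by (auto simp: lin_ext_def)

lemma lin_ext_singleton: "lin_ext f {(e, 0)} = f e"
proof -
  have "{(e', n). (e', n) \<in> {(e, 0)} \<and> (y, m - n) \<in> f e'} = (if (y, m) \<in> f e then {(e, 0)} else {})"
    for y m by auto
  then show ?thesis
    by (auto simp: lin_ext_def)
qed

lemma chainL_addc: "chainL X A \<Longrightarrow> chainL X B \<Longrightarrow> chainL X (addc A B)"
  by (auto simp: chainL_def addc_def)

lemma chainL_lin_ext: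
  assumes "chainL X A"
    and "\<And>e. e \<in> cells X \<Longrightarrow> finite (F e)" "\<And>e. e \<in> cells X \<Longrightarrow> F e \<subseteq> cells Y"
  shows "chainL Y (lin_ext (glift X Y F) A)"
proof -
  let ?B = "\<Union>(e, n)\<in>A. (\<lambda>(y, k). (y, k + n)) ` glift X Y F e"
  have A: "e \<in> cells X" if "(e, n) \<in> A" for e n
    using assms(1) that by (force simp: chainL_def)
  have "finite ?B"
    using assms(1,2) A by (auto simp: chainL_def glift_def)
  moreover have "fst ` ?B \<subseteq> cells Y"
    using assms(3) A by (fastforce simp: glift_def)
  ultimately show ?thesis
    using lin_ext_subset [of "glift X Y F" A] unfolding chainL_def
    by (meson finite_subset image_mono subset_trans)
qed

text \<open>Exponents are nonnegative because \<open>gr\<close> does not drop. The power of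
  \<open>U\<close> absorbs the change of \<open>gr\<close> exactly, as both gradings lie in one
  coset of 2Z, and the dimensions agree.\<close>

lemma fu_map_glift:
  assumes "graded_over r P" "graded_over r Q" "\<And>e. e \<in> cells P \<Longrightarrow> finite (K e)"
    "\<And>e. e \<in> cells P \<Longrightarrow> K e \<subseteq> cells Q"
    "\<And>e y. e \<in> cells P \<Longrightarrow> y \<in> K e \<Longrightarrow> dimc Q y = dimc P e \<and> grc P e \<le> grc Q y"
  shows "fu_map P Q (glift P Q K) 0"
  unfolding fu_map_def
proof (intro ballI conjI)
  fix e assume e: "e \<in> cells P"
  show "finite (glift P Q K e)"
    using assms(3) e by (simp add: glift_def)
  fix p assume "p \<in> glift P Q K e"
  then obtain y where y: "y \<in> K e" "p = (y, \<lfloor>(grc Q y - grc P e) / 2\<rfloor>)"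
    by (auto simp: glift_def)
  then have "y \<in> cells Q" "dimc Q y = dimc P e" "grc P e \<le> grc Q y"
    using assms(4,5) e by blast+
  moreover obtain k l :: int where kl: "grc Q y = r + 2 * of_int k" "grc P e = r + 2 * of_int l"
    using assms(1,2) e \<open>y \<in> cells Q\<close> by (meson graded_over_def)
  moreover from kl have "(grc Q y - grc P e) / 2 = of_int (k - l)"
    by (simp add: field_simps)
  then have "\<lfloor>(grc Q y - grc P e) / 2\<rfloor> = k - l"
    by (simp only: floor_of_int)
  ultimately show "case p of (y, k) \<Rightarrow> y \<in> cells Q \<and> 0 \<le> k \<and>
      maslov Q y - 2 * of_int k = maslov P e + of_int 0"
    by (auto simp: y(2) maslov_def)
qed

text \<open>\<open>K\<close> is strictly equivariant and the involutions preserve \<open>gr\<close>,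
  hence all exponents, so the zero homotopy works.\<close>

lemma commutes_glift:
  assumes "\<And>e. e \<in> cells P \<Longrightarrow> K (invol P e) = invol Q ` K e"
    and "\<And>e. e \<in> cells P \<Longrightarrow> grc P (invol P e) = grc P e"
    and "\<And>e. e \<in> cells Q \<Longrightarrow> grc Q (invol Q e) = grc Q e"
    and "\<And>e. e \<in> cells P \<Longrightarrow> K e \<subseteq> cells Q"
  shows "commutes_up_to_htpy P Q (glift P Q K)"
  unfolding commutes_up_to_htpy_def
proof (intro exI [of _ "\<lambda>e. {}"] conjI ballI)
  show "fu_map P Q (\<lambda>e. {}) 1"
    by (simp add: fu_map_def)
  fix e assume e: "e \<in> cells P"
  have "glift P Q K (invol P e) = (\<lambda>(y, k). (invol Q y, k)) ` glift P Q K e"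
    using assms(1,2) [OF e] assms(3) subsetD [OF assms(4) [OF e]]
    by (auto simp: glift_def image_image intro!: image_cong)
  then show "addc (glift P Q K (invol P e)) ((\<lambda>(y, k). (invol Q y, k)) ` glift P Q K e)
      = addc (lin_ext (dU Q) {}) (lin_ext (\<lambda>e. {}) (dU P e))"
    by simp
qed

section \<open>Equivariant retracts and local equivalence\<close>

lemma chainL_singleton: "e \<in> cells P \<Longrightarrow> chainL P {(e, 0)}"
  by (simp add: chainL_def)

text \<open>Maps preserving the dimension and not lowering \<open>gr\<close> lift to graded maps over the
  polynomial ring. The homotopy \<open>L\<close> is allowed to lower \<open>gr\<close>: it lives over the Laurent
  polynomials only.\<close>

locale equivariant_retract =
  fixes X :: "'c gcx" and Y :: "'d gcx" and r :: rat
    and F :: "'c \<Rightarrow> 'd set" and G :: "'d \<Rightarrow> 'c set" and L :: "'d \<Rightarrow> 'd set"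
  assumes graded: "graded_over r X" "graded_over r Y"
    and finite_cells: "finite (cells X)" "finite (cells Y)"
    and bd_cells: "\<And>e. e \<in> cells X \<Longrightarrow> bd X e \<subseteq> cells X" "\<And>e. e \<in> cells Y \<Longrightarrow> bd Y e \<subseteq> cells Y"
    and F_cells: "\<And>e. e \<in> cells X \<Longrightarrow> F e \<subseteq> cells Y"
    and G_cells: "\<And>e. e \<in> cells Y \<Longrightarrow> G e \<subseteq> cells X"
    and L_cells: "\<And>e. e \<in> cells Y \<Longrightarrow> L e \<subseteq> cells Y"
    and F_deg: "\<And>e y. e \<in> cells X \<Longrightarrow> y \<in> F e \<Longrightarrow> dimc Y y = dimc X e \<and> grc X e \<le> grc Y y"
    and G_deg: "\<And>e y. e \<in> cells Y \<Longrightarrow> y \<in> G e \<Longrightarrow> dimc X y = dimc Y e \<and> grc Y e \<le> grc X y"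
    and invol_grc: "\<And>e. e \<in> cells X \<Longrightarrow> grc X (invol X e) = grc X e"
      "\<And>e. e \<in> cells Y \<Longrightarrow> grc Y (invol Y e) = grc Y e"
    and F_invol: "\<And>e. e \<in> cells X \<Longrightarrow> F (invol X e) = invol Y ` F e"
    and G_invol: "\<And>e. e \<in> cells Y \<Longrightarrow> G (invol Y e) = invol X ` G e"
    and F_bd: "\<And>e. e \<in> cells X \<Longrightarrow> chain_ext F (bd X e) = chain_ext (bd Y) (F e)"
    and G_bd: "\<And>e. e \<in> cells Y \<Longrightarrow> chain_ext G (bd Y e) = chain_ext (bd X) (G e)"
    and GF: "\<And>e. e \<in> cells X \<Longrightarrow> chain_ext G (F e) = {e}"
    and FG: "\<And>e. e \<in> cells Y \<Longrightarrow>
      addc (chain_ext F (G e)) {e} = addc (chain_ext (bd Y) (L e)) (chain_ext L (bd Y e))"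
begin

lemma finites:
  "e \<in> cells X \<Longrightarrow> finite (bd X e)" "e' \<in> cells Y \<Longrightarrow> finite (bd Y e')"
  "e \<in> cells X \<Longrightarrow> finite (F e)" "e' \<in> cells Y \<Longrightarrow> finite (G e')" "e' \<in> cells Y \<Longrightarrow> finite (L e')"
  using finite_cells bd_cells F_cells G_cells L_cells by (meson finite_subset)+

abbreviation "FU \<equiv> glift X Y F"
abbreviation "GU \<equiv> glift Y X G"
abbreviation "LU \<equiv> glift Y Y L"

lemma chainLs:
  "chainL X A \<Longrightarrow> chainL Y (lin_ext FU A)" "chainL Y B \<Longrightarrow> chainL X (lin_ext GU B)"
  "chainL Y B \<Longrightarrow> chainL Y (lin_ext LU B)"
  "chainL X A \<Longrightarrow> chainL X (lin_ext (dU X) A)" "chainL Y B \<Longrightarrow> chainL Y (lin_ext (dU Y) B)"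
  unfolding dU_eq_glift
  by (intro chainL_lin_ext finites F_cells G_cells L_cells bd_cells; assumption)+

lemma slices:
  "chainL X A \<Longrightarrow> slice r Y t (lin_ext FU A) = chain_ext F (slice r X t A)"
  "chainL Y B \<Longrightarrow> slice r X t (lin_ext GU B) = chain_ext G (slice r Y t B)"
  "chainL Y B \<Longrightarrow> slice r Y t (lin_ext LU B) = chain_ext L (slice r Y t B)"
  "chainL X A \<Longrightarrow> slice r X t (lin_ext (dU X) A) = chain_ext (bd X) (slice r X t A)"
  "chainL Y B \<Longrightarrow> slice r Y t (lin_ext (dU Y) B) = chain_ext (bd Y) (slice r Y t B)"
  unfolding dU_eq_glift
  by (intro slice_lin_ext graded F_cells G_cells L_cells bd_cells; assumption)+

lemma FU_dU:
  assumes "chainL X A"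
  shows "lin_ext FU (lin_ext (dU X) A) = lin_ext (dU Y) (lin_ext FU A)"
proof (rule slice_eqI [where r = r and X = Y])
  fix t
  note s = slice_chainL [OF assms, of r t]
  have "chain_ext F (chain_ext (bd X) (slice r X t A)) = chain_ext (bd Y) (chain_ext F (slice r X t A))"
    using s finites F_bd by (subst (1 2) chain_ext_chain_ext) (auto intro!: chain_ext_cong simp: subset_iff)
  then show "slice r Y t (lin_ext FU (lin_ext (dU X) A)) = slice r Y t (lin_ext (dU Y) (lin_ext FU A))"
    using assms by (simp add: slices chainLs)
qed

lemma GU_dU:
  assumes "chainL Y A"
  shows "lin_ext GU (lin_ext (dU Y) A) = lin_ext (dU X) (lin_ext GU A)"
proof (rule slice_eqI [where r = r and X = X])
  fix t
  note s = slice_chainL [OF assms, of r t]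
  have "chain_ext G (chain_ext (bd Y) (slice r Y t A)) = chain_ext (bd X) (chain_ext G (slice r Y t A))"
    using s finites G_bd by (subst (1 2) chain_ext_chain_ext) (auto intro!: chain_ext_cong simp: subset_iff)
  then show "slice r X t (lin_ext GU (lin_ext (dU Y) A)) = slice r X t (lin_ext (dU X) (lin_ext GU A))"
    using assms by (simp add: slices chainLs)
qed

lemma GU_FU:
  assumes "chainL X A"
  shows "lin_ext GU (lin_ext FU A) = A"
proof (rule slice_eqI [where r = r and X = X])
  fix t
  note s = slice_chainL [OF assms, of r t]
  have "chain_ext (\<lambda>e. chain_ext G (F e)) (slice r X t A) = chain_ext (\<lambda>e. {e}) (slice r X t A)"
    by (rule chain_ext_cong) (use s GF in blast)
  moreover have "chain_ext G (chain_ext F (slice r X t A)) = chain_ext (\<lambda>e. chain_ext G (F e)) (slice r X t A)"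
    by (rule chain_ext_chain_ext) (use s finites in blast)+
  ultimately show "slice r X t (lin_ext GU (lin_ext FU A)) = slice r X t A"
    using assms s by (simp add: slices chainLs)
qed

lemma FU_GU:
  assumes "chainL Y A"
  shows "addc (lin_ext FU (lin_ext GU A)) A
    = addc (lin_ext (dU Y) (lin_ext LU A)) (lin_ext LU (lin_ext (dU Y) A))"
proof (rule slice_eqI [where r = r and X = Y])
  fix t
  note s = slice_chainL [OF assms, of r t]
  let ?A = "slice r Y t A"
  have "chain_ext F (chain_ext G ?A) = chain_ext (\<lambda>e. chain_ext F (G e)) ?A"
    "chain_ext (bd Y) (chain_ext L ?A) = chain_ext (\<lambda>e. chain_ext (bd Y) (L e)) ?A"
    "chain_ext L (chain_ext (bd Y) ?A) = chain_ext (\<lambda>e. chain_ext L (bd Y e)) ?A"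
    using s finites by (auto intro!: chain_ext_chain_ext)
  moreover have "chain_ext (\<lambda>e. addc (chain_ext F (G e)) {e}) ?A
      = chain_ext (\<lambda>e. addc (chain_ext (bd Y) (L e)) (chain_ext L (bd Y e))) ?A"
    using s FG by (intro chain_ext_cong) auto
  ultimately have "addc (chain_ext F (chain_ext G ?A)) ?A
      = addc (chain_ext (bd Y) (chain_ext L ?A)) (chain_ext L (chain_ext (bd Y) ?A))"
    using s by (simp add: chain_ext_add_fun)
  then show "slice r Y t (addc (lin_ext FU (lin_ext GU A)) A)
    = slice r Y t (addc (lin_ext (dU Y) (lin_ext LU A)) (lin_ext LU (lin_ext (dU Y) A)))"
    using assms by (simp add: slices chainLs slice_addc)
qed

lemma lin_ext_addc_dU:
  assumes "chainL Y A" "chainL Y B"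
  shows "lin_ext (dU Y) (addc A B) = addc (lin_ext (dU Y) A) (lin_ext (dU Y) B)"
proof (rule slice_eqI [where r = r and X = Y])
  fix t
  show "slice r Y t (lin_ext (dU Y) (addc A B)) = slice r Y t (addc (lin_ext (dU Y) A) (lin_ext (dU Y) B))"
    using assms by (simp add: slices chainL_addc slice_addc chain_ext_addc slice_chainL)
qed

text \<open>A cycle \<open>z\<close> is hit by \<open>GU z\<close> up to the boundary of
  \<open>LU z\<close>. If \<open>FU w\<close> is the boundary of \<open>B\<close>, then
  \<open>w = GU (FU w)\<close> is the boundary of \<open>GU B\<close>.\<close>

lemma loc_hiso_FU: "loc_hiso X Y FU"
  unfolding loc_hiso_def
proof (intro conjI allI impI)
  fix z assume z: "cycleL Y z"
  let ?w = "lin_ext GU z"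
  have "cycleL X ?w"
    using z GU_dU [of z] by (simp add: cycleL_def chainLs)
  moreover have "addc (lin_ext FU ?w) z = lin_ext (dU Y) (lin_ext LU z)"
    using z FU_GU [of z] by (simp add: cycleL_def)
  then have "bdryL Y (addc (lin_ext FU ?w) z)"
    using z chainLs(3) unfolding bdryL_def cycleL_def by blast
  ultimately show "\<exists>w. cycleL X w \<and> bdryL Y (addc (lin_ext FU w) z)"
    by blast
next
  fix w assume w: "cycleL X w \<and> bdryL Y (lin_ext FU w)"
  then obtain B where B: "chainL Y B" "lin_ext FU w = lin_ext (dU Y) B"
    by (auto simp: bdryL_def)
  then have "w = lin_ext (dU X) (lin_ext GU B)"
    using w GU_FU [of w] GU_dU [of B] by (simp add: cycleL_def)
  then show "bdryL X w"
    using B chainLs(2) unfolding bdryL_def by blast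
qed

text \<open>Every cycle \<open>z\<close> is hit exactly, by \<open>FU z\<close>, so the empty chain
  serves as the bounding chain; the homotopy is needed for injectivity only.\<close>

lemma loc_hiso_GU: "loc_hiso Y X GU"
  unfolding loc_hiso_def
proof (intro conjI allI impI)
  fix z assume z: "cycleL X z"
  let ?w = "lin_ext FU z"
  have "cycleL Y ?w"
    using z FU_dU [of z] by (simp add: cycleL_def chainLs)
  moreover have "addc (lin_ext GU ?w) z = lin_ext (dU X) {}"
    using z GU_FU [of z] by (simp add: cycleL_def)
  then have "bdryL X (addc (lin_ext GU ?w) z)"
    unfolding bdryL_def by (intro exI [of _ "{}"]) (simp add: chainL_def)
  ultimately show "\<exists>w. cycleL Y w \<and> bdryL X (addc (lin_ext GU w) z)"
    by blast
next
  fix w assume w: "cycleL Y w \<and> bdryL X (lin_ext GU w)"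
  then obtain B where B: "chainL X B" "lin_ext GU w = lin_ext (dU X) B"
    by (auto simp: bdryL_def)
  \<comment> \<open>For the cycle \<open>w\<close> the homotopy identity says that
    \<open>FU (GU w) + w\<close> is the boundary of \<open>LU w\<close>, and
    \<open>FU (GU w)\<close> is the boundary of \<open>FU B\<close>.\<close>
  let ?C = "addc (lin_ext FU B) (lin_ext LU w)"
  have cw: "chainL Y w" "lin_ext (dU Y) w = {}"
    using w by (auto simp: cycleL_def)
  have "addc (lin_ext (dU Y) (lin_ext FU B)) w = lin_ext (dU Y) (lin_ext LU w)"
    using FU_GU [OF cw(1)] B FU_dU [of B] cw(2) by simp
  then have "w = addc (lin_ext (dU Y) (lin_ext FU B)) (lin_ext (dU Y) (lin_ext LU w))"
    by (metis addc_cancel)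
  then have "w = lin_ext (dU Y) ?C"
    using B cw by (simp add: lin_ext_addc_dU chainLs)
  moreover have "chainL Y ?C"
    using B cw by (simp add: chainL_addc chainLs)
  ultimately show "bdryL Y w"
    unfolding bdryL_def by blast
qed

theorem local_equiv: "local_equiv X Y"
  unfolding local_equiv_def
proof (intro conjI exI)
  show "chain_map X Y FU"
    unfolding chain_map_def
    using FU_dU [OF chainL_singleton]
    by (intro conjI ballI fu_map_glift [OF graded] finites F_cells F_deg) (simp_all add: lin_ext_singleton)
  show "chain_map Y X GU"
    unfolding chain_map_def
    using GU_dU [OF chainL_singleton]
    by (intro conjI ballI fu_map_glift [OF graded(2,1)] finites G_cells G_deg) (simp_all add: lin_ext_singleton)
  show "commutes_up_to_htpy X Y FU" "commutes_up_to_htpy Y X GU"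
    by (intro commutes_glift F_invol G_invol invol_grc F_cells G_cells; assumption)+
  show "loc_hiso X Y FU" "loc_hiso Y X GU"
    by (rule loc_hiso_FU loc_hiso_GU)+
qed

end

section \<open>The double as a retract\<close>

locale splitting =
  fixes X :: "'c gcx" and S :: "'c set"
  assumes split: "split_gc X" and is_splitting: "is_splitting X S"
begin

abbreviation "\<eta> \<equiv> eta X"
abbreviation "J \<equiv> invol X"
abbreviation "d \<equiv> bd X"

text \<open>The cells of \<open>JC\<close>; together with \<open>S\<close> and the fixed cell they
  partition the cells of \<open>X\<close>.\<close>

definition "T = J ` S"

lemma geom: "geom_complex X"
  using split by (simp add: split_gc_def)

lemma finite_cells: "finite (cells X)"
  using geom by (simp add: geom_complex_def)

lemma d_cells: "x \<in> cells X \<Longrightarrow> d x \<subseteq> cells X"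
  using geom by (simp add: geom_complex_def)

lemma finite_d: "x \<in> cells X \<Longrightarrow> finite (d x)"
  using d_cells finite_cells finite_subset by blast

lemma dimc_d: "x \<in> cells X \<Longrightarrow> y \<in> d x \<Longrightarrow> dimc X y = dimc X x - 1"
  using geom by (simp add: geom_complex_def)

lemma d_d: "x \<in> cells X \<Longrightarrow> chain_ext d (d x) = {}"
  using geom by (simp add: geom_complex_def chain_bd_eq)

lemma J_cells: "x \<in> cells X \<Longrightarrow> J x \<in> cells X"
  and J_J: "x \<in> cells X \<Longrightarrow> J (J x) = x"
  and d_J: "x \<in> cells X \<Longrightarrow> d (J x) = J ` d x"
  and grc_J: "x \<in> cells X \<Longrightarrow> grc X (J x) = grc X x"
  using split by (auto simp: split_gc_def)

lemma inj_J: "inj_on J (cells X)"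
  by (metis J_J inj_onI)

lemma eta_cell: "\<eta> \<in> cells X"
  and J_eta [simp]: "J \<eta> = \<eta>"
  and eta_unique: "x \<in> cells X \<Longrightarrow> J x = x \<longleftrightarrow> x = \<eta>"
proof -
  have ex1: "\<exists>!e. e \<in> cells X \<and> J e = e"
    using split by (simp add: split_gc_def)
  from theI' [OF ex1] show *: "\<eta> \<in> cells X" "J \<eta> = \<eta>"
    by (simp_all add: eta_def)
  with ex1 show "x \<in> cells X \<Longrightarrow> J x = x \<longleftrightarrow> x = \<eta>"
    by auto
qed

lemma S_cells: "S \<subseteq> cells X"
  using is_splitting by (simp add: is_splitting_def)

lemma T_cells: "T \<subseteq> cells X"
  using S_cells J_cells by (auto simp: T_def)

lemma S_iff: "x \<in> cells X \<Longrightarrow> x \<noteq> \<eta> \<Longrightarrow> x \<in> S \<longleftrightarrow> J x \<notin> S"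
  using is_splitting eta_unique by (simp add: is_splitting_def)

lemma T_iff: "x \<in> cells X \<Longrightarrow> x \<in> T \<longleftrightarrow> J x \<in> S"
  using J_J J_cells S_cells by (force simp: T_def)

lemma eta_notin [simp]: "\<eta> \<notin> S" "\<eta> \<notin> T"
  using is_splitting T_iff [OF eta_cell] by (auto simp: is_splitting_def)

lemma disjoint: "x \<in> S \<Longrightarrow> x \<notin> T"
  by (metis S_cells S_iff T_iff eta_notin(1) subset_iff)

lemma cells_cases: "x \<in> cells X \<longleftrightarrow> x \<in> S \<or> x \<in> T \<or> x = \<eta>"
  using S_cells T_cells S_iff T_iff eta_cell by blast

lemma J_mem:
  assumes "x \<in> cells X"
  shows "J x \<in> S \<longleftrightarrow> x \<in> T" "J x \<in> T \<longleftrightarrow> x \<in> S" "J x = \<eta> \<longleftrightarrow> x = \<eta>"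
proof -
  show "J x \<in> S \<longleftrightarrow> x \<in> T" "J x \<in> T \<longleftrightarrow> x \<in> S"
    using assms by (simp_all add: T_iff J_cells J_J)
  show "J x = \<eta> \<longleftrightarrow> x = \<eta>"
    using J_J [OF assms] J_eta by metis
qed

lemma J_image_Int:
  assumes "A \<subseteq> cells X"
  shows "J ` (A \<inter> S) = J ` A \<inter> T" "J ` (A \<inter> T) = J ` A \<inter> S"
  using J_mem [OF subsetD [OF assms]] by auto

lemma chain_ext_d_J:
  assumes "A \<subseteq> cells X"
  shows "chain_ext d (J ` A) = J ` chain_ext d A"
proof -
  have "chain_ext d (J ` A) = chain_ext (\<lambda>e. J ` d e) A"
    using assms by (subst chain_ext_reindex)
      (auto intro: inj_on_subset [OF inj_J] intro!: chain_ext_cong simp: d_J subset_iff)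
  also have "\<dots> = J ` chain_ext d A"
    using assms d_cells by (intro chain_ext_image [OF inj_J]) auto
  finally show ?thesis .
qed

lemma chain_ext_d_cells: "A \<subseteq> cells X \<Longrightarrow> chain_ext d A \<subseteq> cells X"
  using d_cells by (intro chain_ext_subset) auto

lemma eta_mem_J_image: "A \<subseteq> cells X \<Longrightarrow> \<eta> \<in> J ` A \<longleftrightarrow> \<eta> \<in> A"
  by (metis J_eta J_mem(3) image_iff subset_iff)

section \<open>Parity consequences of \<open>\<partial>\<partial> = 0\<close>\<close>

lemma decompose:
  assumes "A \<subseteq> cells X"
  shows "A = addc (addc (A \<inter> S) (A \<inter> T)) (if \<eta> \<in> A then {\<eta>} else {})"
proof (rule set_eqI)
  fix x
  show "x \<in> A \<longleftrightarrow> x \<in> addc (addc (A \<inter> S) (A \<inter> T)) (if \<eta> \<in> A then {\<eta>} else {})"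
    using subsetD [OF assms, of x] disjoint [of x] cells_cases [of x] by (cases "x = \<eta>") auto
qed

text \<open>This is the coefficient of \<open>y\<close> in \<open>\<partial>\<partial>x = 0\<close>,
  with \<open>\<partial>x\<close> split into its parts in \<open>S\<close>, in \<open>T\<close> and
  its multiple of \<eta>.\<close>

lemma d_d_split:
  assumes "x \<in> cells X"
  shows "y \<in> chain_ext d (d x \<inter> S) \<longleftrightarrow>
    (y \<in> chain_ext d (d x \<inter> T)) \<noteq> (\<eta> \<in> d x \<and> y \<in> d \<eta>)"
proof -
  have "chain_ext d (d x) = addc (addc (chain_ext d (d x \<inter> S)) (chain_ext d (d x \<inter> T)))
      (if \<eta> \<in> d x then d \<eta> else {})"
    using finite_d [OF assms]
    by (subst decompose [OF d_cells [OF assms]]) (auto simp: chain_ext_addc simp del: in_addc)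
  then show ?thesis
    using arg_cong [OF d_d [OF assms], of "\<lambda>A. y \<in> A"] by (cases "\<eta> \<in> d x") auto
qed

lemma eta_notin_d_eta: "\<eta> \<notin> d \<eta>"
  using dimc_d [OF eta_cell] by force

text \<open>In the coefficient of \<eta> the \<open>\<partial>\<eta>\<close> term drops out, since
  \<eta> does not appear in its own boundary.\<close>

lemma eta_d_d_sym:
  assumes "x \<in> cells X"
  shows "\<eta> \<in> chain_ext d (d x \<inter> S) \<longleftrightarrow> \<eta> \<in> chain_ext d (d x \<inter> T)"
  using d_d_split [OF assms, of \<eta>] eta_notin_d_eta by simp

text \<open>By dimension: cells in the boundary of \<open>A\<close> have dimension
  \<open>dim x - 2\<close>, while \<eta> has dimension \<open>dim x - 1\<close> or
  \<open>dim x\<close>.\<close>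

lemma eta_notin_d_d:
  assumes "x \<in> cells X" "\<eta> \<in> d x \<or> x = \<eta>" "A \<subseteq> d x"
  shows "\<eta> \<notin> chain_ext d A"
proof -
  have "\<eta> \<notin> d y" if "y \<in> A" for y
  proof
    assume "\<eta> \<in> d y"
    then show False
      using that assms dimc_d [of x y] dimc_d [of x \<eta>] dimc_d [of y \<eta>] d_cells by fastforce
  qed
  then have "{y \<in> A. \<eta> \<in> d y} = {}"
    by blast
  then have "card {y \<in> A. \<eta> \<in> d y} = 0"
    by (simp only: card.empty)
  then show ?thesis
    by (simp add: chain_ext_def)
qed

section \<open>The differential of the double\<close>

text \<open>Since \<open>\<partial>\<partial>x = 0\<close>, the cell \<open>\<eta>\<close> appears in \<open>\<partial>b\<close> iff it appears in
  \<open>\<partial>(\<partial>x \<inter> S)\<close>; this form of the condition for the \<open>\<theta>\<close>-term makes sense for all cells and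
  is symmetric under \<open>J\<close>.\<close>

definition extra :: "'c \<Rightarrow> 'c dcell set" where
  "extra x = (if \<eta> \<in> d x then {if x \<in> S then Omega else JOmega}
     else if \<eta> \<in> chain_ext d (d x \<inter> S) then {Theta} else {})"

lemma image_Old_addc: "Old ` addc A B = addc (Old ` A) (Old ` B)"
  by (intro image_addc) (simp add: inj_on_def)

text \<open>Here \<open>b = J(\<partial>x \<inter> T)\<close> and \<open>a\<close> is the sum of
  \<open>\<partial>x \<inter> S\<close> and \<open>b\<close>, so the two copies of \<open>b\<close>
  in \<open>a + b + Jb\<close> cancel.\<close>

lemma dbd_S_eq:
  assumes "x \<in> S"
  shows "dbd_S X S x = addc (addc (Old ` (d x \<inter> S)) (Old ` (d x \<inter> T))) (extra x)"
proof -
  have x: "x \<in> cells X"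
    using assms S_cells by blast
  have b: "bpart X S x = J ` (d x \<inter> T)"
    by (simp add: bpart_def T_def)
  have sub: "d x \<inter> T \<subseteq> cells X"
    using T_cells by blast
  have "J ` J ` (d x \<inter> T) = d x \<inter> T"
    using sub J_J by (force simp: image_image)
  then have "addc (apart X S x) (addc (bpart X S x) (J ` bpart X S x)) = addc (d x \<inter> S) (d x \<inter> T)"
    by (simp add: apart_def b addc_assoc)
  moreover have "\<eta> \<in> chain_bd d (bpart X S x) \<longleftrightarrow> \<eta> \<in> chain_ext d (d x \<inter> S)"
    using x sub by (simp add: b chain_bd_eq chain_ext_d_J eta_mem_J_image chain_ext_d_cells eta_d_d_sym)
  ultimately show ?thesis
    using assms by (simp add: dbd_S_def extra_def image_Old_addc)
qed

lemma dJ_simps [simp]: "dJ X (Old x) = Old (J x)" "dJ X Omega = JOmega" "dJ X JOmega = Omega"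
  "dJ X Theta = Theta"
  by (simp_all add: dJ_def)

text \<open>\<open>J\<close> fixes \<eta> and exchanges the boundary parts in \<open>S\<close> and
  \<open>T\<close>, between which the \<theta> condition is symmetric. Exactly one of
  \<open>x\<close> and \<open>Jx\<close> lies in \<open>S\<close>, which matches the swap of
  \<omega> and \<open>J\<omega>\<close>.\<close>

lemma dJ_extra:
  assumes "x \<in> cells X" "x \<noteq> \<eta>"
  shows "dJ X ` extra (J x) = extra x"
proof -
  have "\<eta> \<in> d (J x) \<longleftrightarrow> \<eta> \<in> d x"
    using assms by (simp add: d_J eta_mem_J_image d_cells)
  moreover have "d (J x) \<inter> S = J ` (d x \<inter> T)"
    using assms by (simp add: J_image_Int d_J d_cells)
  moreover have "d x \<inter> T \<subseteq> cells X"
    using T_cells by blast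
  then have "\<eta> \<in> chain_ext d (J ` (d x \<inter> T)) \<longleftrightarrow> \<eta> \<in> chain_ext d (d x \<inter> S)"
    using assms by (simp add: chain_ext_d_J eta_mem_J_image chain_ext_d_cells eta_d_d_sym)
  ultimately show ?thesis
    using assms by (simp add: extra_def S_iff)
qed

lemma bd_double_Old:
  assumes "x \<in> cells X" "x \<noteq> \<eta>"
  shows "bd (double X S \<Delta>) (Old x) = addc (addc (Old ` (d x \<inter> S)) (Old ` (d x \<inter> T))) (extra x)"
proof (cases "x \<in> S")
  case False
  \<comment> \<open>\<open>J\<close> is injective on the cells of \<open>X\<close>, and injectivity
    is what moves images through sums; hence all chains are kept inside \<open>?U\<close>.\<close>
  let ?U = "Old ` cells X \<union> {Omega, JOmega, Theta}"
  have Jx: "J x \<in> S" "J x \<in> cells X"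
    using assms False S_iff J_cells by auto
  have inj: "inj_on (dJ X) ?U"
    using inj_J by (auto simp: inj_on_def)
  have add: "dJ X ` addc A B = addc (dJ X ` A) (dJ X ` B)" if "A \<subseteq> ?U" "B \<subseteq> ?U" for A B
    using that by (intro image_addc inj_on_subset [OF inj]) auto
  have sub: "Old ` (d (J x) \<inter> S) \<subseteq> ?U" "Old ` (d (J x) \<inter> T) \<subseteq> ?U" "extra (J x) \<subseteq> ?U"
    using S_cells T_cells by (auto simp: extra_def)
  have "dJ X ` dbd_S X S (J x)
      = addc (addc (dJ X ` Old ` (d (J x) \<inter> S)) (dJ X ` Old ` (d (J x) \<inter> T))) (dJ X ` extra (J x))"
    unfolding dbd_S_eq [OF Jx(1)] by (simp only: add sub addc_subset)
  moreover have "dJ X ` Old ` J ` A = Old ` A" if "A \<subseteq> cells X" for A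
    using that J_J by (force simp: image_image)
  then have "dJ X ` Old ` (d (J x) \<inter> S) = Old ` (d x \<inter> T)" "dJ X ` Old ` (d (J x) \<inter> T) = Old ` (d x \<inter> S)"
    using assms S_cells T_cells by (simp_all add: d_J d_cells le_infI2 flip: J_image_Int)
  ultimately show ?thesis
    using assms False by (simp add: double_def dJ_extra addc_commute)
qed (simp add: double_def dbd_S_eq)

text \<open>\<open>\<partial>\<eta>\<close> is \<open>J\<close>-invariant, so \<zeta> is its part in
  \<open>S\<close> and \<open>J\<zeta>\<close> its part in \<open>T\<close>.\<close>

lemma bd_double_eta:
  "bd (double X S \<Delta>) Omega = addc (Old ` (d \<eta> \<inter> S)) (Old ` (d \<eta> \<inter> T))"
  "bd (double X S \<Delta>) JOmega = addc (Old ` (d \<eta> \<inter> S)) (Old ` (d \<eta> \<inter> T))"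
  "bd (double X S \<Delta>) Theta = {Omega, JOmega}"
proof -
  have d: "d \<eta> \<subseteq> cells X" "J ` d \<eta> = d \<eta>"
    using d_cells [OF eta_cell] d_J [OF eta_cell] by simp_all
  have "zeta X S = d \<eta> \<inter> S"
    using J_image_Int [OF d(1)] d(2) by (simp add: zeta_def flip: T_def)
  moreover have "J ` (d \<eta> \<inter> S) = d \<eta> \<inter> T"
    using J_image_Int [OF d(1)] d(2) by simp
  ultimately show
    "bd (double X S \<Delta>) Omega = addc (Old ` (d \<eta> \<inter> S)) (Old ` (d \<eta> \<inter> T))"
    "bd (double X S \<Delta>) JOmega = addc (Old ` (d \<eta> \<inter> S)) (Old ` (d \<eta> \<inter> T))"
    "bd (double X S \<Delta>) Theta = {Omega, JOmega}"
    by (simp_all add: double_def image_Old_addc)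
qed

section \<open>The tensor product and the three maps\<close>

abbreviation layer :: "xdcell \<Rightarrow> 'c set \<Rightarrow> ('c \<times> xdcell) set" where
  "layer s A \<equiv> (\<lambda>x. (x, s)) ` A"

lemma mem_layer [simp]: "(y, t) \<in> layer s A \<longleftrightarrow> t = s \<and> y \<in> A"
  by auto

abbreviation "TX \<Delta> \<equiv> tensor X (XD \<Delta>)"

lemma bd_TX:
  "bd (TX \<Delta>) (x, Al) = layer Al (d x)"
  "bd (TX \<Delta>) (x, JAl) = layer JAl (d x)"
  "bd (TX \<Delta>) (x, Be) = addc (layer Be (d x)) {(x, Al), (x, JAl)}"
  by (simp_all add: tensor_def XD_def)

text \<open>For \<open>x\<close> in \<open>S\<close> with \<open>\<partial>x = a + (1 + J)b + \<dots>\<close> the set \<open>d x \<inter> T\<close> is \<open>Jb\<close>. The term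
  \<open>Jb\<cdot>\<beta>\<close> turns the \<open>Jb\<cdot>\<alpha>\<close> in \<open>\<partial>(x\<cdot>\<alpha>)\<close> into the required \<open>Jb\<cdot>J\<alpha>\<close>.\<close>

fun incl :: "'c dcell \<Rightarrow> ('c \<times> xdcell) set" where
  "incl (Old x) = (if x \<in> S then insert (x, Al) (layer Be (d x \<inter> T))
     else insert (x, JAl) (layer Be (d x \<inter> S)))"
| "incl Omega = insert (\<eta>, Al) (layer Be (d \<eta> \<inter> T))"
| "incl JOmega = insert (\<eta>, JAl) (layer Be (d \<eta> \<inter> S))"
| "incl Theta = {(\<eta>, Be)}"

text \<open>If \<eta> appears in \<open>\<partial>x\<close> for \<open>x\<close> in
  \<open>T\<close>, the boundary of \<open>x\<cdot>\<alpha>\<close> contributes \<omega>, but that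
  of \<open>x\<close> in the double contains \<open>J\<omega>\<close>; adding \<theta> repairs this,
  its boundary being \<open>\<omega> + J\<omega>\<close>. The rule at \<open>J\<alpha>\<close> is
  the mirror image.\<close>

fun retr :: "'c \<times> xdcell \<Rightarrow> 'c dcell set" where
  "retr (x, Al) = (if x = \<eta> then {Omega} else if x \<in> S then {Old x}
     else insert (Old x) (if \<eta> \<in> d x then {Theta} else {}))"
| "retr (x, JAl) = (if x = \<eta> then {JOmega} else if x \<in> T then {Old x}
     else insert (Old x) (if \<eta> \<in> d x then {Theta} else {}))"
| "retr (x, Be) = (if x = \<eta> then {Theta} else {})"

text \<open>For \<open>x\<close> other than \<eta>, \<open>x\<cdot>\<beta>\<close> is paired with
  the one of \<open>x\<cdot>\<alpha>\<close>, \<open>x\<cdot>J\<alpha>\<close> that is not the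
  leading term of \<open>incl (Old x)\<close>.\<close>

fun htpy :: "'c \<times> xdcell \<Rightarrow> ('c \<times> xdcell) set" where
  "htpy (x, Al) = (if x \<in> T then {(x, Be)} else {})"
| "htpy (x, JAl) = (if x \<in> S then {(x, Be)} else {})"
| "htpy (x, Be) = {}"

lemma chain_ext_layer: "chain_ext f (layer s A) = chain_ext (\<lambda>x. f (x, s)) A"
  by (rule chain_ext_reindex) (simp add: inj_on_def)

lemma chain_ext_Old: "chain_ext f (Old ` A) = chain_ext (\<lambda>x. f (Old x)) A"
  by (rule chain_ext_reindex) (simp add: inj_on_def)

lemma chain_ext_to_layer: "chain_ext (\<lambda>x. layer s (f x)) A = layer s (chain_ext f A)"
  by (rule chain_ext_image [where B = UNIV]) (auto simp: inj_on_def)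

lemma finite_sub: "A \<subseteq> cells X \<Longrightarrow> finite A"
  using finite_cells finite_subset by blast

lemma chain_ext_bd_TX:
  assumes "A \<subseteq> cells X"
  shows "chain_ext (bd (TX \<Delta>)) (layer Al A) = layer Al (chain_ext d A)"
    "chain_ext (bd (TX \<Delta>)) (layer JAl A) = layer JAl (chain_ext d A)"
    "chain_ext (bd (TX \<Delta>)) (layer Be A) = addc (layer Be (chain_ext d A)) (addc (layer Al A) (layer JAl A))"
proof -
  note fin = finite_sub [OF assms]
  show "chain_ext (bd (TX \<Delta>)) (layer Al A) = layer Al (chain_ext d A)"
    "chain_ext (bd (TX \<Delta>)) (layer JAl A) = layer JAl (chain_ext d A)"
    by (simp_all add: chain_ext_layer bd_TX chain_ext_to_layer)
  have "{(x, Al), (x, JAl)} = addc (layer Al {x}) (layer JAl {x})" for x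
    by (auto simp: addc_disjoint)
  then show "chain_ext (bd (TX \<Delta>)) (layer Be A) = addc (layer Be (chain_ext d A)) (addc (layer Al A) (layer JAl A))"
    using fin by (simp only: chain_ext_layer bd_TX chain_ext_add_fun chain_ext_to_layer chain_ext_id)
qed

lemma chain_ext_incl:
  assumes "A \<subseteq> cells X"
  shows "chain_ext incl (Old ` (A \<inter> S)) = addc (layer Al (A \<inter> S)) (layer Be (chain_ext d (A \<inter> S) \<inter> T))"
    "chain_ext incl (Old ` (A \<inter> T)) = addc (layer JAl (A \<inter> T)) (layer Be (chain_ext d (A \<inter> T) \<inter> S))"
proof -
  have fin: "finite (A \<inter> S)" "finite (A \<inter> T)"
    using finite_sub [OF assms] by auto
  have "chain_ext (\<lambda>x. incl (Old x)) (A \<inter> S)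
      = chain_ext (\<lambda>x. addc (layer Al {x}) (layer Be (d x \<inter> T))) (A \<inter> S)"
    by (intro chain_ext_cong) (auto simp: addc_def)
  then show "chain_ext incl (Old ` (A \<inter> S)) = addc (layer Al (A \<inter> S)) (layer Be (chain_ext d (A \<inter> S) \<inter> T))"
    using fin by (simp only: chain_ext_Old chain_ext_add_fun chain_ext_to_layer chain_ext_id chain_ext_Int)
  have "chain_ext (\<lambda>x. incl (Old x)) (A \<inter> T)
      = chain_ext (\<lambda>x. addc (layer JAl {x}) (layer Be (d x \<inter> S))) (A \<inter> T)"
    by (intro chain_ext_cong) (auto simp: addc_def dest: disjoint)
  then show "chain_ext incl (Old ` (A \<inter> T)) = addc (layer JAl (A \<inter> T)) (layer Be (chain_ext d (A \<inter> T) \<inter> S))"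
    using fin by (simp only: chain_ext_Old chain_ext_add_fun chain_ext_to_layer chain_ext_id chain_ext_Int)
qed

section \<open>The inclusion is a chain map\<close>

lemma finite_extra: "finite (extra x)"
  by (simp add: extra_def)

text \<open>Only the \<beta> coefficients need \<open>\<partial>\<partial>x = 0\<close>: it trades
  the boundary of \<open>\<partial>x \<inter> S\<close> for that of
  \<open>\<partial>x \<inter> T\<close>, up to \<open>\<partial>\<eta>\<close>, supplied by \<omega>
  or \<open>J\<omega>\<close>. A leftover \<eta> term is the image of \<theta>.\<close>

lemma incl_bd_Old:
  assumes "x \<in> cells X" "x \<noteq> \<eta>"
  shows "chain_ext incl (bd (double X S \<Delta>) (Old x)) = chain_ext (bd (TX \<Delta>)) (incl (Old x))"
proof -
  note dx = d_cells [OF assms(1)] finite_d [OF assms(1)]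
  note parity = d_d_split [OF assms(1)]
  note eta = eta_d_d_sym [OF assms(1)] eta_notin_d_d [OF assms(1)]
  have sub: "d x \<inter> T \<subseteq> cells X" "d x \<inter> S \<subseteq> cells X"
    using dx by auto
  have lhs: "chain_ext incl (bd (double X S \<Delta>) (Old x))
      = addc (addc (addc (layer Al (d x \<inter> S)) (layer Be (chain_ext d (d x \<inter> S) \<inter> T)))
          (addc (layer JAl (d x \<inter> T)) (layer Be (chain_ext d (d x \<inter> T) \<inter> S)))) (chain_ext incl (extra x))"
    using dx by (simp add: bd_double_Old [OF assms] chain_ext_addc finite_extra chain_ext_incl)
  show ?thesis
  proof (cases "x \<in> S")
    case True
    then have "incl (Old x) = addc {(x, Al)} (layer Be (d x \<inter> T))"
      by (auto simp: addc_def)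
    then have rhs: "chain_ext (bd (TX \<Delta>)) (incl (Old x)) = addc (layer Al (d x))
        (addc (layer Be (chain_ext d (d x \<inter> T))) (addc (layer Al (d x \<inter> T)) (layer JAl (d x \<inter> T))))"
      using dx sub by (simp add: chain_ext_addc chain_ext_bd_TX bd_TX(1))
    show ?thesis
      unfolding lhs rhs
    proof (rule set_eqI, clarify)
      fix y s
      \<comment> \<open>The \<omega> and \<theta> cases exclude each other by dimension, so a
        disjunction can replace the sum.\<close>
      have "(y, s) \<in> chain_ext incl (extra x) \<longleftrightarrow>
          (\<eta> \<in> d x \<and> (s = Al \<and> y = \<eta> \<or> s = Be \<and> y \<in> d \<eta> \<and> y \<in> T)) \<or>
          (\<eta> \<in> chain_ext d (d x \<inter> S) \<and> s = Be \<and> y = \<eta>)"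
        using True eta(2) [of "d x \<inter> S"] by (auto simp: extra_def)
      moreover have "y \<in> chain_ext d (d x \<inter> T) \<Longrightarrow> y \<in> cells X" "y \<in> d x \<Longrightarrow> y \<in> cells X"
        using chain_ext_d_cells [OF sub(1)] dx(1) by auto
      ultimately show "(y, s) \<in> addc (addc (addc (layer Al (d x \<inter> S)) (layer Be (chain_ext d (d x \<inter> S) \<inter> T)))
          (addc (layer JAl (d x \<inter> T)) (layer Be (chain_ext d (d x \<inter> T) \<inter> S)))) (chain_ext incl (extra x))
        \<longleftrightarrow> (y, s) \<in> addc (layer Al (d x))
        (addc (layer Be (chain_ext d (d x \<inter> T))) (addc (layer Al (d x \<inter> T)) (layer JAl (d x \<inter> T))))"
        using parity [of y] eta(1) eta_notin_d_eta disjoint [of y] cells_cases [of y]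
        by (cases "y = \<eta>"; cases s) auto
    qed
  next
    case False
    then have T: "x \<in> T"
      using assms cells_cases by blast
    from False have "incl (Old x) = addc {(x, JAl)} (layer Be (d x \<inter> S))"
      by (auto simp: addc_def)
    then have rhs: "chain_ext (bd (TX \<Delta>)) (incl (Old x)) = addc (layer JAl (d x))
        (addc (layer Be (chain_ext d (d x \<inter> S))) (addc (layer Al (d x \<inter> S)) (layer JAl (d x \<inter> S))))"
      using dx sub by (simp add: chain_ext_addc chain_ext_bd_TX bd_TX(2))
    show ?thesis
      unfolding lhs rhs
    proof (rule set_eqI, clarify)
      fix y s
      have "(y, s) \<in> chain_ext incl (extra x) \<longleftrightarrow>
          (\<eta> \<in> d x \<and> (s = JAl \<and> y = \<eta> \<or> s = Be \<and> y \<in> d \<eta> \<and> y \<in> S)) \<or>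
          (\<eta> \<in> chain_ext d (d x \<inter> S) \<and> s = Be \<and> y = \<eta>)"
        using False eta(2) [of "d x \<inter> S"] by (auto simp: extra_def)
      moreover have "y \<in> chain_ext d (d x \<inter> S) \<Longrightarrow> y \<in> cells X" "y \<in> d x \<Longrightarrow> y \<in> cells X"
        using chain_ext_d_cells [OF sub(2)] dx(1) by auto
      ultimately show "(y, s) \<in> addc (addc (addc (layer Al (d x \<inter> S)) (layer Be (chain_ext d (d x \<inter> S) \<inter> T)))
          (addc (layer JAl (d x \<inter> T)) (layer Be (chain_ext d (d x \<inter> T) \<inter> S)))) (chain_ext incl (extra x))
        \<longleftrightarrow> (y, s) \<in> addc (layer JAl (d x))
        (addc (layer Be (chain_ext d (d x \<inter> S))) (addc (layer Al (d x \<inter> S)) (layer JAl (d x \<inter> S))))"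
        using parity [of y] eta(1) eta_notin_d_eta disjoint [of y] cells_cases [of y]
        by (cases "y = \<eta>"; cases s) auto
    qed
  qed
qed

text \<open>Since \<eta> is not in \<open>\<partial>\<eta>\<close>,
  \<open>\<partial>\<partial>\<eta> = 0\<close> says that the parts of
  \<open>\<partial>\<eta>\<close> in \<open>S\<close> and in \<open>T\<close> have the same
  boundary.\<close>

lemma incl_bd_eta:
  assumes "c \<in> {Omega, JOmega, Theta}"
  shows "chain_ext incl (bd (double X S \<Delta>) c) = chain_ext (bd (TX \<Delta>)) (incl c)"
proof -
  note d\<eta> = d_cells [OF eta_cell] finite_d [OF eta_cell]
  have sub: "d \<eta> \<inter> T \<subseteq> cells X" "d \<eta> \<inter> S \<subseteq> cells X"
    using d\<eta> by auto
  have parity: "y \<in> chain_ext d (d \<eta> \<inter> S) \<longleftrightarrow> y \<in> chain_ext d (d \<eta> \<inter> T)" for y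
    using d_d_split [OF eta_cell] eta_notin_d_eta by simp
  have notin: "\<eta> \<notin> chain_ext d (d \<eta> \<inter> T)"
    by (rule eta_notin_d_d [OF eta_cell]) auto
  have *: "y \<in> chain_ext d (d \<eta> \<inter> T) \<Longrightarrow> y \<in> cells X" "y \<in> d \<eta> \<Longrightarrow> y \<in> cells X" for y
    using chain_ext_d_cells [OF sub(1)] d\<eta>(1) by auto
  have boundary: "chain_ext incl (addc (Old ` (d \<eta> \<inter> S)) (Old ` (d \<eta> \<inter> T)))
      = addc (addc (layer Al (d \<eta> \<inter> S)) (layer Be (chain_ext d (d \<eta> \<inter> S) \<inter> T)))
          (addc (layer JAl (d \<eta> \<inter> T)) (layer Be (chain_ext d (d \<eta> \<inter> T) \<inter> S)))"
    using d\<eta> by (simp add: chain_ext_addc chain_ext_incl)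
  consider "c = Omega" | "c = JOmega" | "c = Theta"
    using assms by blast
  then show ?thesis
  proof cases
    case 1
    have "incl Omega = addc {(\<eta>, Al)} (layer Be (d \<eta> \<inter> T))"
      by (auto simp: addc_def)
    then have rhs: "chain_ext (bd (TX \<Delta>)) (incl Omega) = addc (layer Al (d \<eta>))
        (addc (layer Be (chain_ext d (d \<eta> \<inter> T))) (addc (layer Al (d \<eta> \<inter> T)) (layer JAl (d \<eta> \<inter> T))))"
      using d\<eta> sub by (simp add: chain_ext_addc chain_ext_bd_TX bd_TX(1))
    show ?thesis
      unfolding 1 bd_double_eta boundary rhs
    proof (rule set_eqI, clarify)
      fix y s
      show "(y, s) \<in> addc (addc (layer Al (d \<eta> \<inter> S)) (layer Be (chain_ext d (d \<eta> \<inter> S) \<inter> T)))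
          (addc (layer JAl (d \<eta> \<inter> T)) (layer Be (chain_ext d (d \<eta> \<inter> T) \<inter> S)))
        \<longleftrightarrow> (y, s) \<in> addc (layer Al (d \<eta>))
        (addc (layer Be (chain_ext d (d \<eta> \<inter> T))) (addc (layer Al (d \<eta> \<inter> T)) (layer JAl (d \<eta> \<inter> T))))"
        using parity [of y] notin eta_notin_d_eta disjoint [of y] cells_cases [of y] * [of y]
        by (cases "y = \<eta>"; cases s) auto
    qed
  next
    case 2
    have "incl JOmega = addc {(\<eta>, JAl)} (layer Be (d \<eta> \<inter> S))"
      by (auto simp: addc_def)
    then have rhs: "chain_ext (bd (TX \<Delta>)) (incl JOmega) = addc (layer JAl (d \<eta>))
        (addc (layer Be (chain_ext d (d \<eta> \<inter> S))) (addc (layer Al (d \<eta> \<inter> S)) (layer JAl (d \<eta> \<inter> S))))"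
      using d\<eta> sub by (simp add: chain_ext_addc chain_ext_bd_TX bd_TX(2))
    show ?thesis
      unfolding 2 bd_double_eta boundary rhs
    proof (rule set_eqI, clarify)
      fix y s
      show "(y, s) \<in> addc (addc (layer Al (d \<eta> \<inter> S)) (layer Be (chain_ext d (d \<eta> \<inter> S) \<inter> T)))
          (addc (layer JAl (d \<eta> \<inter> T)) (layer Be (chain_ext d (d \<eta> \<inter> T) \<inter> S)))
        \<longleftrightarrow> (y, s) \<in> addc (layer JAl (d \<eta>))
        (addc (layer Be (chain_ext d (d \<eta> \<inter> S))) (addc (layer Al (d \<eta> \<inter> S)) (layer JAl (d \<eta> \<inter> S))))"
        using parity [of y] notin eta_notin_d_eta disjoint [of y] cells_cases [of y] * [of y]
        by (cases "y = \<eta>"; cases s) auto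
    qed
  next
    case 3
    have "chain_ext incl {Omega, JOmega} = addc (incl Omega) (incl JOmega)"
      by (simp add: chain_ext_insert)
    \<comment> \<open>The \<beta> terms of the two images are the parts of
      \<open>\<partial>\<eta>\<close> in \<open>T\<close> and in \<open>S\<close>, which together
      are all of \<open>\<partial>\<eta>\<close>.\<close>
    also have "\<dots> = addc (layer Be (d \<eta>)) {(\<eta>, Al), (\<eta>, JAl)}"
    proof (rule set_eqI, clarify)
      fix y s
      show "(y, s) \<in> addc (incl Omega) (incl JOmega)
          \<longleftrightarrow> (y, s) \<in> addc (layer Be (d \<eta>)) {(\<eta>, Al), (\<eta>, JAl)}"
        using eta_notin_d_eta disjoint [of y] cells_cases [of y] * [of y]
        by (cases "y = \<eta>"; cases s) auto
    qed
    finally show ?thesis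
      by (simp add: 3 bd_double_eta bd_TX)
  qed
qed

section \<open>The retraction is a chain map and a left inverse\<close>

lemma chain_ext_decompose:
  assumes "A \<subseteq> cells X"
  shows "chain_ext f A = addc (addc (chain_ext f (A \<inter> S)) (chain_ext f (A \<inter> T)))
    (if \<eta> \<in> A then f \<eta> else {})"
proof -
  have "chain_ext f (addc (addc (A \<inter> S) (A \<inter> T)) (if \<eta> \<in> A then {\<eta>} else {})) =
      addc (addc (chain_ext f (A \<inter> S)) (chain_ext f (A \<inter> T))) (if \<eta> \<in> A then f \<eta> else {})"
    using finite_sub [OF assms] by (simp add: chain_ext_addc)
  then show ?thesis
    unfolding decompose [OF assms, symmetric] .
qed

lemma chain_ext_single_Old: "finite A \<Longrightarrow> chain_ext (\<lambda>x. {Old x}) A = Old ` A"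
  using chain_ext_image [of Old UNIV A "\<lambda>x. {x}"] by (simp add: inj_on_def)

lemma chain_ext_Theta:
  "chain_ext (\<lambda>x. if \<eta> \<in> d x then {Theta} else {}) A
    = (if \<eta> \<in> chain_ext d A then {Theta} else {})"
proof -
  \<comment> \<open>As the image of \<open>B \<inter> {\<eta>}\<close> under a constant map,
    injective on a singleton, the indicator commutes with linear extension.\<close>
  have ind: "(if \<eta> \<in> B then {Theta} else {}) = (\<lambda>_. Theta) ` (B \<inter> {\<eta>})" for B
    by auto
  show ?thesis
    unfolding ind by (subst chain_ext_image [where B = "{\<eta>}"]) (auto simp: chain_ext_Int)
qed

text \<open>The \<theta> corrections add up linearly: their sum over a set of cells records whether
  \<eta> appears in its boundary, the same test as in \<open>extra\<close>.\<close>

lemma chain_ext_retr: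
  assumes "A \<subseteq> cells X"
  shows "chain_ext retr (layer Al A) = addc (addc (Old ` (A \<inter> S)) (Old ` (A \<inter> T)))
      (addc (if \<eta> \<in> chain_ext d (A \<inter> T) then {Theta} else {}) (if \<eta> \<in> A then {Omega} else {}))"
    and "chain_ext retr (layer JAl A) = addc (addc (Old ` (A \<inter> S)) (Old ` (A \<inter> T)))
      (addc (if \<eta> \<in> chain_ext d (A \<inter> S) then {Theta} else {}) (if \<eta> \<in> A then {JOmega} else {}))"
    and "chain_ext retr (layer Be A) = (if \<eta> \<in> A then {Theta} else {})"
proof -
  note fin = finite_sub [OF assms]
  have Old_Theta: "chain_ext (\<lambda>x. addc {Old x} (if \<eta> \<in> d x then {Theta} else {})) B
      = addc (Old ` B) (if \<eta> \<in> chain_ext d B then {Theta} else {})" if "finite B" for B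
    using that by (simp only: chain_ext_add_fun chain_ext_single_Old chain_ext_Theta)
  have *: "x \<in> S \<Longrightarrow> x \<noteq> \<eta> \<and> x \<notin> T" "x \<in> T \<Longrightarrow> x \<noteq> \<eta> \<and> x \<notin> S" for x
    using disjoint eta_notin by blast+
  have "chain_ext (\<lambda>x. retr (x, Al)) (A \<inter> S) = chain_ext (\<lambda>x. {Old x}) (A \<inter> S)"
    "chain_ext (\<lambda>x. retr (x, JAl)) (A \<inter> T) = chain_ext (\<lambda>x. {Old x}) (A \<inter> T)"
    "chain_ext (\<lambda>x. retr (x, Al)) (A \<inter> T)
      = chain_ext (\<lambda>x. addc {Old x} (if \<eta> \<in> d x then {Theta} else {})) (A \<inter> T)"
    "chain_ext (\<lambda>x. retr (x, JAl)) (A \<inter> S)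
      = chain_ext (\<lambda>x. addc {Old x} (if \<eta> \<in> d x then {Theta} else {})) (A \<inter> S)"
    by (rule chain_ext_cong; use * in \<open>simp add: addc_disjoint\<close>)+
  then show "chain_ext retr (layer Al A) = addc (addc (Old ` (A \<inter> S)) (Old ` (A \<inter> T)))
      (addc (if \<eta> \<in> chain_ext d (A \<inter> T) then {Theta} else {}) (if \<eta> \<in> A then {Omega} else {}))"
    "chain_ext retr (layer JAl A) = addc (addc (Old ` (A \<inter> S)) (Old ` (A \<inter> T)))
      (addc (if \<eta> \<in> chain_ext d (A \<inter> S) then {Theta} else {}) (if \<eta> \<in> A then {JOmega} else {}))"
    unfolding chain_ext_layer chain_ext_decompose [OF assms]
    using fin by (auto simp: Old_Theta chain_ext_single_Old)
  have "chain_ext (\<lambda>x. retr (x, Be)) (A \<inter> B) = chain_ext (\<lambda>x. {}) (A \<inter> B)" if "\<eta> \<notin> B" for B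
    by (rule chain_ext_cong) (use that in auto)
  then show "chain_ext retr (layer Be A) = (if \<eta> \<in> A then {Theta} else {})"
    unfolding chain_ext_layer chain_ext_decompose [OF assms] by simp
qed

lemma retr_bd:
  assumes "x \<in> cells X"
  shows "chain_ext retr (bd (TX \<Delta>) (x, s)) = chain_ext (bd (double X S \<Delta>)) (retr (x, s))"
proof -
  note dx = d_cells [OF assms] finite_d [OF assms]
  note eta = eta_d_d_sym [OF assms] eta_notin_d_d [OF assms]
  consider "x = \<eta>" | "x \<in> S" "x \<notin> T" "x \<noteq> \<eta>" | "x \<in> T" "x \<notin> S" "x \<noteq> \<eta>"
    using assms disjoint [of x] cells_cases [of x] by auto
  note cases = this
  have pair: "chain_ext (bd (double X S \<Delta>)) {Old x, Theta}
      = addc (bd (double X S \<Delta>) (Old x)) {Omega, JOmega}"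
    by (simp add: chain_ext_insert bd_double_eta)
  show ?thesis
  proof (cases s)
    case Al
    show ?thesis
      using cases dx eta(1) eta(2) [of "d x \<inter> T"] eta_notin_d_eta
      by cases (auto simp: Al bd_TX chain_ext_retr bd_double_eta bd_double_Old assms extra_def pair)
  next
    case JAl
    show ?thesis
      using cases dx eta(1) eta(2) [of "d x \<inter> S"] eta_notin_d_eta
      by cases (auto simp: JAl bd_TX chain_ext_retr bd_double_eta bd_double_Old assms extra_def pair)
  next
    case Be
    \<comment> \<open>If \<eta> appears in \<open>\<partial>x\<close>, exactly one of the images of
      \<open>x\<cdot>\<alpha>\<close> and \<open>x\<cdot>J\<alpha>\<close> carries a \<theta>,
      cancelling the one from \<open>\<partial>x\<cdot>\<beta>\<close>. For
      \<open>x = \<eta>\<close> the sum is \<open>\<omega> + J\<omega>\<close>.\<close>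
    have "chain_ext retr (bd (TX \<Delta>) (x, Be))
        = addc (if \<eta> \<in> d x then {Theta} else {}) (addc (retr (x, Al)) (retr (x, JAl)))"
      using dx by (simp add: bd_TX chain_ext_addc chain_ext_retr chain_ext_insert del: retr.simps)
    then show ?thesis
      using cases eta_notin_d_eta by cases (auto simp: Be bd_double_eta addc_def)
  qed
qed

text \<open>For cells other than \<theta>, the \<beta> terms of the inclusion avoid \<eta> and are
  killed, and the leading term has no \<theta> correction.\<close>

lemma retr_incl:
  assumes "c \<in> cells (double X S \<Delta>)"
  shows "chain_ext retr (incl c) = {c}"
proof (cases c)
  case (Old x)
  have x: "x \<in> cells X" "x \<noteq> \<eta>"
    using assms by (auto simp: double_def Old)
  then have "d x \<inter> S \<subseteq> cells X" "d x \<inter> T \<subseteq> cells X"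
    using d_cells by auto
  moreover have "x \<notin> S \<Longrightarrow> x \<in> T"
    using x cells_cases by blast
  ultimately show ?thesis
    using x finite_d [of x] by (simp add: Old chain_ext_insert chain_ext_retr image_iff)
next
  case Omega
  have "d \<eta> \<inter> T \<subseteq> cells X"
    using d_cells [OF eta_cell] by auto
  then show ?thesis
    using finite_d [OF eta_cell] by (simp add: Omega chain_ext_insert chain_ext_retr image_iff)
next
  case JOmega
  have "d \<eta> \<inter> S \<subseteq> cells X"
    using d_cells [OF eta_cell] by auto
  then show ?thesis
    using finite_d [OF eta_cell] by (simp add: JOmega chain_ext_insert chain_ext_retr image_iff)
qed simp

section \<open>The homotopy from the other composite to the identity\<close>

lemma chain_ext_htpy:
  assumes "A \<subseteq> cells X"
  shows "chain_ext htpy (layer Al A) = layer Be (A \<inter> T)"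
    "chain_ext htpy (layer JAl A) = layer Be (A \<inter> S)"
    "chain_ext htpy (layer Be A) = {}"
proof -
  have "htpy (x, Al) = layer Be ({x} \<inter> T)" "htpy (x, JAl) = layer Be ({x} \<inter> S)" for x
    by auto
  then show "chain_ext htpy (layer Al A) = layer Be (A \<inter> T)"
    "chain_ext htpy (layer JAl A) = layer Be (A \<inter> S)"
    using finite_sub [OF assms]
    by (simp_all only: chain_ext_layer chain_ext_to_layer chain_ext_Int chain_ext_id)
qed (simp add: chain_ext_layer)

text \<open>For \<open>x\<close> in \<open>S\<close>, both sides at \<open>x\<cdot>\<alpha>\<close>
  are the \<beta> terms of the inclusion. At \<open>x\<cdot>J\<alpha>\<close> the boundary of
  \<open>x\<cdot>\<beta>\<close> supplies \<open>x\<cdot>\<alpha> + x\<cdot>J\<alpha>\<close> and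
  \<open>\<partial>x\<cdot>\<beta>\<close>; the second summand removes the part in \<open>S\<close>,
  and an \<eta> term matches the \<theta> correction.\<close>

lemma incl_retr:
  assumes "x \<in> cells X"
  shows "addc (chain_ext incl (retr (x, s))) {(x, s)}
    = addc (chain_ext (bd (TX \<Delta>)) (htpy (x, s))) (chain_ext htpy (bd (TX \<Delta>) (x, s)))"
proof -
  note dx = d_cells [OF assms] finite_d [OF assms]
  consider "x = \<eta>" | "x \<in> S" "x \<notin> T" "x \<noteq> \<eta>" | "x \<in> T" "x \<notin> S" "x \<noteq> \<eta>"
    using assms disjoint [of x] cells_cases [of x] by auto
  note cases = this
  have pair: "chain_ext incl {Old x, Theta} = addc (incl (Old x)) {(\<eta>, Be)}"
    by (simp add: chain_ext_insert)
  have dS: "y \<in> d x \<Longrightarrow> y \<in> S \<or> y \<in> T \<or> y = \<eta>" for y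
    using dx cells_cases by blast
  show ?thesis
  proof (cases s)
    case Al
    show ?thesis
      using cases dx
      by cases (auto simp: Al bd_TX chain_ext_htpy pair addc_def dest: dS disjoint)
  next
    case JAl
    show ?thesis
      using cases dx
      by cases (auto simp: JAl bd_TX chain_ext_htpy pair addc_def dest: dS disjoint)
  next
    case Be
    have "chain_ext htpy (bd (TX \<Delta>) (x, Be)) = addc (htpy (x, Al)) (htpy (x, JAl))"
      using dx by (simp add: bd_TX chain_ext_addc chain_ext_htpy chain_ext_insert del: htpy.simps)
    then show ?thesis
      using cases by cases (auto simp: Be addc_def)
  qed
qed

section \<open>Equivariance of the inclusion and the retraction\<close>

lemma invol_TX: "invol (TX \<Delta>) (x, Al) = (J x, JAl)" "invol (TX \<Delta>) (x, JAl) = (J x, Al)"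
  "invol (TX \<Delta>) (x, Be) = (J x, Be)"
  by (simp_all add: tensor_def XD_def)

lemma invol_TX_layer: "invol (TX \<Delta>) ` layer Be A = layer Be (J ` A)"
  by (simp add: image_image invol_TX)

lemma incl_invol:
  assumes "c \<in> cells (double X S \<Delta>)"
  shows "incl (dJ X c) = invol (TX \<Delta>) ` incl c"
proof (cases c)
  case (Old x)
  then have x: "x \<in> cells X" "x \<noteq> \<eta>"
    using assms by (auto simp: double_def)
  then have "J x \<in> S \<longleftrightarrow> x \<notin> S"
    using S_iff by blast
  then show ?thesis
    using J_image_Int [OF d_cells [OF x(1)]] d_J [OF x(1)]
    by (simp add: Old invol_TX invol_TX_layer)
next
  case Omega
  then show ?thesis
    using J_image_Int [OF d_cells [OF eta_cell]] d_J [OF eta_cell]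
    by (simp add: invol_TX invol_TX_layer)
next
  case JOmega
  then show ?thesis
    using J_image_Int [OF d_cells [OF eta_cell]] d_J [OF eta_cell]
    by (simp add: invol_TX invol_TX_layer)
qed (simp add: invol_TX)

lemma retr_invol:
  assumes "x \<in> cells X"
  shows "retr (invol (TX \<Delta>) (x, s)) = dJ X ` retr (x, s)"
proof -
  have "\<eta> \<in> d (J x) \<longleftrightarrow> \<eta> \<in> d x"
    using assms by (simp add: d_J eta_mem_J_image d_cells)
  then show ?thesis
    using J_mem [OF assms] by (cases s) (simp_all add: invol_TX)
qed

section \<open>Gradings and assembly of the retract\<close>

theorem double_local_equiv:
  assumes "ereal (2 * of_int \<Delta>) \<le> width X"
  shows "local_equiv (double X S \<Delta>) (TX \<Delta>)"
proof -
  let ?D = "double X S \<Delta>"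
  obtain r where r: "graded_over r X"
    using geom by (auto simp: geom_complex_def graded_over_def)
  \<comment> \<open>Needed for the terms \<open>y\<cdot>\<beta>\<close> of the inclusion and, with
    \<open>y = \<eta>\<close>, for the \<theta> correction of the retraction.\<close>
  have width: "grc X x \<le> grc X y - 2 * of_int \<Delta>" if "x \<in> cells X" "y \<in> d x" for x y
  proof -
    have "ereal (2 * of_int \<Delta>) \<le> ereal (of_rat (grc X y - grc X x))"
      using assms that unfolding width_def le_INF_iff by blast
    then have "of_rat (2 * of_int \<Delta>) \<le> (of_rat (grc X y - grc X x) :: real)"
      by (simp add: of_rat_mult)
    then show ?thesis
      by (simp only: of_rat_less_eq)
  qed
  have cells_D: "cells ?D = Old ` (cells X - {\<eta>}) \<union> {Omega, JOmega, Theta}"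
    by (simp add: double_def)
  have cells_TX: "cells (TX \<Delta>) = cells X \<times> UNIV"
    by (simp add: tensor_def XD_def)
  have dimc_D: "dimc ?D (Old x) = dimc X x" "dimc ?D Omega = dimc X \<eta>"
      "dimc ?D JOmega = dimc X \<eta>" "dimc ?D Theta = dimc X \<eta> + 1" for x
    by (simp_all add: double_def)
  have dimc_TX: "dimc (TX \<Delta>) (x, s) = dimc X x + (if s = Be then 1 else 0)" for x s
    by (simp add: tensor_def XD_def)
  have grc_D: "grc ?D (Old x) = grc X x" "grc ?D Omega = grc X \<eta>"
      "grc ?D JOmega = grc X \<eta>" "grc ?D Theta = grc X \<eta> - 2 * of_int \<Delta>" for x
    by (simp_all add: double_def)
  have grc_TX: "grc (TX \<Delta>) (x, s) = grc X x - (if s = Be then 2 * of_int \<Delta> else 0)" for x s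
    by (simp add: tensor_def XD_def)
  show ?thesis
  proof (rule equivariant_retract.local_equiv)
    show "equivariant_retract ?D (TX \<Delta>) r incl retr htpy"
    proof
      \<comment> \<open>The cells \<theta> and \<open>x\<cdot>\<beta>\<close> shift
        \<open>gr\<close> by \<open>2\<Delta>\<close> and so stay in the coset of
        \<open>r\<close>.\<close>
      have shift: "\<exists>k::int. a - 2 * of_int \<Delta> = r + 2 * of_int k"
        if "\<exists>k::int. a = r + 2 * of_int k" for a
      proof -
        from that obtain k :: int where "a = r + 2 * of_int k"
          by blast
        then have "a - 2 * of_int \<Delta> = r + 2 * of_int (k - \<Delta>)"
          by simp
        then show ?thesis by blast
      qed
      show "graded_over r ?D" "graded_over r (TX \<Delta>)"
        using r shift eta_cell by (auto simp: graded_over_def cells_D cells_TX grc_D grc_TX)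
      show "finite (cells ?D)" "finite (cells (TX \<Delta>))"
      proof -
        have "(UNIV :: xdcell set) = {Al, JAl, Be}"
          using xdcell.exhaust by auto
        then have "finite (UNIV :: xdcell set)"
          by (metis finite.emptyI finite.insertI)
        then show "finite (cells (TX \<Delta>))"
          using finite_cells by (simp add: cells_TX)
      qed (simp add: cells_D finite_cells)
      have Old_sub: "Old ` (d x \<inter> S) \<subseteq> cells ?D" "Old ` (d x \<inter> T) \<subseteq> cells ?D"
        if "x \<in> cells X" for x
        using d_cells [OF that] by (auto simp: cells_D)
      show "bd ?D e \<subseteq> cells ?D" if "e \<in> cells ?D" for e
      proof (cases e)
        case (Old x)
        then have x: "x \<in> cells X" "x \<noteq> \<eta>"
          using that by (auto simp: cells_D)
        have "extra x \<subseteq> cells ?D"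
          by (simp add: extra_def cells_D)
        then show ?thesis
          using Old_sub [OF x(1)] unfolding Old bd_double_Old [OF x] by (intro addc_subset)
      qed (use Old_sub [OF eta_cell] in \<open>simp_all add: bd_double_eta addc_subset\<close>,
          simp add: cells_D)
      show "bd (TX \<Delta>) e \<subseteq> cells (TX \<Delta>)" if "e \<in> cells (TX \<Delta>)" for e
      proof (cases e)
        case (Pair x s)
        then show ?thesis
          using that d_cells [of x]
          by (cases s) (auto simp: cells_TX bd_TX intro!: addc_subset)
      qed
      show "incl e \<subseteq> cells (TX \<Delta>)" if "e \<in> cells ?D" for e
        using that d_cells eta_cell by (cases e) (auto simp: cells_TX cells_D)
      show "retr e \<subseteq> cells ?D" if "e \<in> cells (TX \<Delta>)" for e
        using that by (cases e rule: retr.cases) (auto simp: cells_TX cells_D)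
      show "htpy e \<subseteq> cells (TX \<Delta>)" if "e \<in> cells (TX \<Delta>)" for e
        using that by (cases e rule: htpy.cases) (auto simp: cells_TX)
      show "dimc (TX \<Delta>) y = dimc ?D e \<and> grc ?D e \<le> grc (TX \<Delta>) y"
        if "e \<in> cells ?D" "y \<in> incl e" for e y
        using that dimc_d width eta_cell
        by (cases e) (auto simp: cells_D dimc_D dimc_TX grc_D grc_TX split: if_splits)
      show "dimc ?D y = dimc (TX \<Delta>) e \<and> grc (TX \<Delta>) e \<le> grc ?D y"
        if "e \<in> cells (TX \<Delta>)" "y \<in> retr e" for e y
        using that dimc_d width
        by (cases e rule: retr.cases)
          (auto simp: cells_TX dimc_D dimc_TX grc_D grc_TX split: if_splits)
      show "grc ?D (invol ?D e) = grc ?D e" if "e \<in> cells ?D" for e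
        using that by (cases e) (auto simp: cells_D grc_D grc_J double_def)
      show "grc (TX \<Delta>) (invol (TX \<Delta>) e) = grc (TX \<Delta>) e" if "e \<in> cells (TX \<Delta>)" for e
        using that by (cases e rule: retr.cases) (auto simp: cells_TX invol_TX grc_TX grc_J)
      have invol_D: "invol ?D = dJ X"
        by (simp add: double_def)
      show "incl (invol ?D e) = invol (TX \<Delta>) ` incl e" if "e \<in> cells ?D" for e
        using incl_invol [OF that] by (simp add: invol_D)
      show "retr (invol (TX \<Delta>) e) = invol ?D ` retr e" if "e \<in> cells (TX \<Delta>)" for e
        using that retr_invol by (auto simp: cells_TX invol_D)
      show "chain_ext incl (bd ?D e) = chain_ext (bd (TX \<Delta>)) (incl e)" if "e \<in> cells ?D" for e
        using that incl_bd_Old incl_bd_eta unfolding cells_D by blast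
      show "chain_ext retr (bd (TX \<Delta>) e) = chain_ext (bd ?D) (retr e)" if "e \<in> cells (TX \<Delta>)" for e
        using that retr_bd by (cases e) (simp add: cells_TX)
      show "chain_ext retr (incl e) = {e}" if "e \<in> cells ?D" for e
        using that by (rule retr_incl)
      show "addc (chain_ext incl (retr e)) {e}
          = addc (chain_ext (bd (TX \<Delta>)) (htpy e)) (chain_ext htpy (bd (TX \<Delta>) e))"
        if "e \<in> cells (TX \<Delta>)" for e
        using that incl_retr by (cases e) (simp add: cells_TX)
    qed
  qed
qed

end

theorem theorem4p3:
  fixes X :: "'c gcx" and S :: "'c set" and \<Delta> :: int
  assumes "iota_complex X"
    and "0 \<le> \<Delta>" and "even \<Delta>"
    and "ereal (2 * of_int \<Delta>) \<le> width X"
    and "is_splitting X S"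
  shows "local_equiv (double X S \<Delta>) (tensor X (XD \<Delta>))"
proof -
  interpret splitting X S
    using assms by unfold_locales (simp_all add: iota_complex_def)
  show ?thesis
    using assms(4) by (rule double_local_equiv)
qed

end
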